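(* Let $K$ be the group with finite presentation $$K=\langle\, a,s,t,u \mid a^2,\ [a,a^t],\ [s,t],\ [s,u],\ [t,u],\ a^{-s}aa^t,\ a^{-u}a^t \,\rangle .$$ Then $K$ has unbounded dead-end depth with respect to the finite generating set $$\mathcal{A}=\{\,a,s,t,u,as,at,au,sa,ta,ua,asa,ata,aua\,\},$$ but the dead-end depth of every element of $K$ is at most $2$ with respect to the finite generating set $$\mathcal{B}=\mathcal{A}\cup\{\,tu,atu,tau,tua,atau,atua,taua,ataua,\ ut^{-1},aut^{-1},tat^{-1},t^{-1}at,atat^{-1},at^{-1}at\,\}.$$
   Context: Notation: $[a,b]=a^{-1}b^{-1}ab$, $a^b=b^{-1}ab$, $a^{-b}=b^{-1}a^{-1}b$. For a group $G$ with finite generating set $\mathcal{S}$, let $d_{\mathcal{S}}$ be the associated word metric ($d_{\mathcal{S}}(g,h)$ is the length of a shortest word in $\mathcal{S}^{\pm1}$ representing $g^{-1}h$). The dead-end depth (or depth) of $g\in G$ with respect to $\mathcal{S}$ is the distance, in $d_{\mathcal{S}}$, from $g$ to the complement in $G$ of the closed ball of radius $d_{\mathcal{S}}(1,g)$ centered at $1$; i.e. $\min\{d_{\mathcal{S}}(g,h) : d_{\mathcal{S}}(1,h)>d_{\mathcal{S}}(1,g)\}$, and it is $\infty$ if that ball is all of $G$. Depth is unbounded with respect to $\mathcal{S}$ if for every $N$ there is an element of $G$ of depth greater than $N$. *)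

theory Defs
  imports "HOL-Algebra.Generated_Groups" "HOL-Library.Extended_Nat"
begin

section \<open>Groups given by generators and relators\<close>

text \<open>
  The letter \<open>(x, True)\<close> stands for the generator \<open>x\<close> and \<open>(x, False)\<close> for its formal
  inverse.  All elements of the type \<open>'x\<close> are generators.
\<close>

type_synonym 'x word = "('x \<times> bool) list"

fun inv_letter :: "'x \<times> bool \<Rightarrow> 'x \<times> bool" where
  "inv_letter (x, b) = (x, \<not> b)"

definition inv_word :: "'x word \<Rightarrow> 'x word" where
  "inv_word w = rev (map inv_letter w)"

text \<open>Conventions: \<open>v\<^sup>w = w\<^sup>-\<^sup>1 v w\<close> and \<open>[v, w] = v\<^sup>-\<^sup>1 w\<^sup>-\<^sup>1 v w\<close>.\<close>

definition conj_word :: "'x word \<Rightarrow> 'x word \<Rightarrow> 'x word" where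
  "conj_word v w = inv_word w @ v @ w"

definition comm_word :: "'x word \<Rightarrow> 'x word \<Rightarrow> 'x word" where
  "comm_word v w = inv_word v @ inv_word w @ v @ w"

inductive pres_eq :: "'x word set \<Rightarrow> 'x word \<Rightarrow> 'x word \<Rightarrow> bool" for R where
  refl: "pres_eq R w w"
| sym: "pres_eq R v w \<Longrightarrow> pres_eq R w v"
| trans: "pres_eq R u v \<Longrightarrow> pres_eq R v w \<Longrightarrow> pres_eq R u w"
| cancel: "pres_eq R (u @ [l, inv_letter l] @ v) (u @ v)"
| relator: "r \<in> R \<Longrightarrow> pres_eq R (u @ r @ v) (u @ v)"

definition pres_rel :: "'x word set \<Rightarrow> ('x word \<times> 'x word) set" where
  "pres_rel R = {(v, w). pres_eq R v w}"

definition word_class :: "'x word set \<Rightarrow> 'x word \<Rightarrow> 'x word set" where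
  "word_class R w = pres_rel R `` {w}"

definition presented_group :: "'x word set \<Rightarrow> 'x word set monoid" where
  "presented_group R =
    \<lparr> carrier = UNIV // pres_rel R,
      mult = (\<lambda>P Q. \<Union>v\<in>P. \<Union>w\<in>Q. word_class R (v @ w)),
      one = word_class R [] \<rparr>"

lemma equiv_pres_rel: "equiv UNIV (pres_rel R)"
  by (rule equivI)
    (simp_all add: pres_rel_def refl_on_def sym_def trans_def pres_eq.refl,
      metis pres_eq.sym, metis pres_eq.trans)

lemma word_class_eq_iff: "word_class R v = word_class R w \<longleftrightarrow> pres_eq R v w"
  using eq_equiv_class_iff[OF equiv_pres_rel, of v w R]
  by (simp add: word_class_def pres_rel_def)

lemma carrier_presented_group: "carrier (presented_group R) = range (word_class R)"
  by (auto simp: presented_group_def quotient_def word_class_def)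

lemma one_presented_group: "\<one>\<^bsub>presented_group R\<^esub> = word_class R []"
  by (simp add: presented_group_def)

lemma pres_eq_append_left: "pres_eq R v w \<Longrightarrow> pres_eq R (p @ v) (p @ w)"
proof (induction rule: pres_eq.induct)
  case (cancel u l v)
  then show ?case using pres_eq.cancel[of R "p @ u" l v] by simp
next
  case (relator r u v)
  then show ?case using pres_eq.relator[of r R "p @ u" v] by simp
qed (fact pres_eq.refl, erule pres_eq.sym, erule (1) pres_eq.trans)

lemma pres_eq_append_right: "pres_eq R v w \<Longrightarrow> pres_eq R (v @ p) (w @ p)"
proof (induction rule: pres_eq.induct)
  case (cancel u l v)
  then show ?case using pres_eq.cancel[of R u l "v @ p"] by simp
next
  case (relator r u v)
  then show ?case using pres_eq.relator[of r R u "v @ p"] by simp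
qed (fact pres_eq.refl, erule pres_eq.sym, erule (1) pres_eq.trans)

lemma pres_eq_append:
  "pres_eq R v v' \<Longrightarrow> pres_eq R w w' \<Longrightarrow> pres_eq R (v @ w) (v' @ w')"
  by (rule pres_eq.trans[OF pres_eq_append_right pres_eq_append_left])

lemma mult_word_class:
  "word_class R v \<otimes>\<^bsub>presented_group R\<^esub> word_class R w = word_class R (v @ w)"
proof -
  have "word_class R (v' @ w') = word_class R (v @ w)"
    if "v' \<in> word_class R v" "w' \<in> word_class R w" for v' w'
    unfolding word_class_eq_iff
    by (rule pres_eq.sym, rule pres_eq_append) (use that in \<open>auto simp: word_class_def pres_rel_def\<close>)
  moreover have "v \<in> word_class R v" "w \<in> word_class R w"
    by (auto simp: word_class_def pres_rel_def intro: pres_eq.refl)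
  ultimately have "(\<Union>v'\<in>word_class R v. \<Union>w'\<in>word_class R w. word_class R (v' @ w')) =
      word_class R (v @ w)"
    by blast
  then show ?thesis
    by (simp add: presented_group_def)
qed

lemma inv_letter_inv_letter [simp]: "inv_letter (inv_letter l) = l"
  by (cases l) simp

lemma pres_eq_inv_word_left: "pres_eq R (inv_word w @ w) []"
proof (induction w)
  case Nil
  then show ?case by (simp add: inv_word_def pres_eq.refl)
next
  case (Cons l w)
  have "pres_eq R (inv_word w @ [inv_letter l, inv_letter (inv_letter l)] @ w) (inv_word w @ w)"
    by (rule pres_eq.cancel)
  with Cons show ?case
    using pres_eq.trans[of R "inv_word (l # w) @ l # w" "inv_word w @ w" "[]"]
    by (simp add: inv_word_def)
qed

lemma group_presented_group: "group (presented_group R)"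
proof (rule groupI)
  show "\<exists>y\<in>carrier (presented_group R). y \<otimes>\<^bsub>presented_group R\<^esub> x = \<one>\<^bsub>presented_group R\<^esub>"
    if x: "x \<in> carrier (presented_group R)" for x
  proof -
    obtain w where "x = word_class R w"
      using x by (auto simp: carrier_presented_group)
    then show ?thesis
      by (intro bexI[of _ "word_class R (inv_word w)"])
        (auto simp: carrier_presented_group mult_word_class one_presented_group
          word_class_eq_iff pres_eq_inv_word_left)
  qed
qed (auto simp: carrier_presented_group mult_word_class one_presented_group)

section \<open>Word metric and dead-end depth\<close>

text \<open>
  Distances take values in \<^typ>\<open>enat\<close>, where the infimum of the empty set is \<open>\<infinity>\<close>; for a
  generating set \<open>S\<close> the word metric is finite.
\<close>

definition word_dist :: "('a, 'b) monoid_scheme \<Rightarrow> 'a set \<Rightarrow> 'a \<Rightarrow> 'a \<Rightarrow> enat" where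
  "word_dist G S g h =
    Inf {enat (length ws) | ws. set ws \<subseteq> S \<union> m_inv G ` S \<and>
      foldr (mult G) ws \<one>\<^bsub>G\<^esub> = inv\<^bsub>G\<^esub> g \<otimes>\<^bsub>G\<^esub> h}"

definition dead_end_depth :: "('a, 'b) monoid_scheme \<Rightarrow> 'a set \<Rightarrow> 'a \<Rightarrow> enat" where
  "dead_end_depth G S g =
    Inf {word_dist G S g h | h. h \<in> carrier G \<and> word_dist G S \<one>\<^bsub>G\<^esub> h > word_dist G S \<one>\<^bsub>G\<^esub> g}"

definition unbounded_dead_end_depth :: "('a, 'b) monoid_scheme \<Rightarrow> 'a set \<Rightarrow> bool" where
  "unbounded_dead_end_depth G S \<longleftrightarrow>
    (\<forall>N::nat. \<exists>g\<in>carrier G. dead_end_depth G S g > enat N)"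

definition finite_generating_set :: "('a, 'b) monoid_scheme \<Rightarrow> 'a set \<Rightarrow> bool" where
  "finite_generating_set G S \<longleftrightarrow> finite S \<and> S \<subseteq> carrier G \<and> generate G S = carrier G"

section \<open>The group K\<close>

datatype K_gen = Gen_a | Gen_s | Gen_t | Gen_u

abbreviation w_a :: "K_gen word" where "w_a \<equiv> [(Gen_a, True)]"
abbreviation w_s :: "K_gen word" where "w_s \<equiv> [(Gen_s, True)]"
abbreviation w_t :: "K_gen word" where "w_t \<equiv> [(Gen_t, True)]"
abbreviation w_u :: "K_gen word" where "w_u \<equiv> [(Gen_u, True)]"

text \<open>
  The last two relators are \<open>a\<^sup>-\<^sup>s a a\<^sup>t\<close> and \<open>a\<^sup>-\<^sup>u a\<^sup>t\<close>, where
  \<open>x\<^sup>-\<^sup>y = y\<^sup>-\<^sup>1 x\<^sup>-\<^sup>1 y\<close>.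
\<close>

definition K_relators :: "K_gen word set" where
  "K_relators =
    { w_a @ w_a,
      comm_word w_a (conj_word w_a w_t),
      comm_word w_s w_t,
      comm_word w_s w_u,
      comm_word w_t w_u,
      conj_word (inv_word w_a) w_s @ w_a @ conj_word w_a w_t,
      conj_word (inv_word w_a) w_u @ conj_word w_a w_t }"

definition K :: "K_gen word set monoid" where
  "K = presented_group K_relators"

definition gens_A :: "K_gen word set set" where
  "gens_A = (let a = w_a; s = w_s; t = w_t; u = w_u in
    word_class K_relators `
      { a, s, t, u, a @ s, a @ t, a @ u, s @ a, t @ a, u @ a,
        a @ s @ a, a @ t @ a, a @ u @ a })"

definition gens_B :: "K_gen word set set" where
  "gens_B = gens_A \<union> (let a = w_a; t = w_t; u = w_u; t' = inv_word w_t in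
    word_class K_relators `
      { t @ u, a @ t @ u, t @ a @ u, t @ u @ a,
        a @ t @ a @ u, a @ t @ u @ a, t @ a @ u @ a, a @ t @ a @ u @ a,
        u @ t', a @ u @ t', t @ a @ t', t' @ a @ t, a @ t @ a @ t', a @ t' @ a @ t })"

end

theory Submission
  imports Defs
begin

text \<open>
  \<open>K\<close> is a lamplighter group: with \<open>e i n\<close> the conjugate of \<open>a\<close> by \<open>(s\<^sup>i t\<^sup>n)\<^sup>-\<^sup>1\<close>, the \<open>e i n\<close> are commuting
  involutions with \<open>e (i - 1) n = e i n \<otimes> e i (n - 1)\<close>, and every element is a product of such lamps times
  \<open>z p q r = s\<^sup>p t\<^sup>q u\<^sup>r\<close>, where \<open>z p q r\<close> moves the lamplighter to the lamp \<open>(p, q + r)\<close>.  Because of the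
  triangle relation, the lamps on a path from the origin generate all lamps in the smallest triangle
  \<open>n \<le> \<alpha>\<close>, \<open>i \<le> \<beta>\<close>, \<open>i + n \<ge> -\<gamma>\<close> containing the path.  So the length of an element is the length of a shortest
  path to its end point that touches the three sides of a triangle containing its lamps.

  For \<open>A\<close>, the element with lamps \<open>(0, N)\<close>, \<open>(N, 0)\<close>, \<open>(0, -N)\<close> and the lamplighter at the origin needs a closed
  path of length \<open>6 N\<close>, and elements close to it need at most that much.  For \<open>B\<close>, a letter contributes at
  most 2 to \<open>2 |\<Delta>i| + |\<Delta>n| + |\<Delta>d|\<close>, where \<open>n = q + r\<close> and \<open>d = q - r\<close>, and this budget can be used up except for
  at most two unpaired changes of \<open>n\<close>.  Multiplying by \<open>(t u\<^sup>-\<^sup>1)\<^sup>\<plusminus>\<^sup>2\<close> so that \<open>|d|\<close> grows by 4 does not change the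
  lamps and therefore increases the length.
\<close>

section \<open>The lamps and the position of the lamplighter\<close>

locale baumslag = group G for G (structure) +
  fixes a s t u
  assumes gen_closed [simp]: "a \<in> carrier G" "s \<in> carrier G" "t \<in> carrier G" "u \<in> carrier G"
    and a_a: "a \<otimes> a = \<one>"
    and st: "s \<otimes> t = t \<otimes> s" and su: "s \<otimes> u = u \<otimes> s" and tu: "t \<otimes> u = u \<otimes> t"
    and a_at: "a \<otimes> (inv t \<otimes> a \<otimes> t) = (inv t \<otimes> a \<otimes> t) \<otimes> a"
    and a_s: "inv s \<otimes> a \<otimes> s = a \<otimes> (inv t \<otimes> a \<otimes> t)"
    and a_u: "inv u \<otimes> a \<otimes> u = inv t \<otimes> a \<otimes> t"

lemma (in group) commute_inv:
  assumes "x \<in> carrier G" "y \<in> carrier G" "x \<otimes> y = y \<otimes> x"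
  shows "inv x \<otimes> y = y \<otimes> inv x"
proof -
  have "inv x \<otimes> y = inv x \<otimes> (y \<otimes> x) \<otimes> inv x"
    using assms by (simp add: m_assoc)
  also have "\<dots> = y \<otimes> inv x"
    using assms by (simp flip: assms(3) m_assoc)
  finally show ?thesis .
qed

lemma (in group) commute_int_pow:
  assumes "x \<in> carrier G" "y \<in> carrier G" "x \<otimes> y = y \<otimes> x"
  shows "x [^] (k::int) \<otimes> y = y \<otimes> x [^] k"
proof -
  have nat: "x [^] (n::nat) \<otimes> y = y \<otimes> x [^] n" for n
  proof (induction n)
    case (Suc n)
    have "x [^] Suc n \<otimes> y = x [^] n \<otimes> y \<otimes> x"
      using assms by (simp add: m_assoc)
    then show ?case
      using assms by (simp add: Suc m_assoc)
  qed (use assms in simp)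
  show ?thesis
  proof (cases k rule: int_cases2)
    case (nonneg n)
    then show ?thesis
      by (simp only: int_pow_int nat)
  next
    case (nonpos n)
    have "inv (x [^] n) \<otimes> y = y \<otimes> inv (x [^] n)"
      by (intro commute_inv nat nat_pow_closed assms)
    with nonpos show ?thesis
      by (simp only: int_pow_neg_int[OF assms(1)])
  qed
qed

context baumslag
begin

definition z :: "int \<Rightarrow> int \<Rightarrow> int \<Rightarrow> 'a" where
  "z p q r = s [^] p \<otimes> (t [^] q \<otimes> u [^] r)"

lemma z_closed [simp]: "z p q r \<in> carrier G"
  by (simp add: z_def)

lemma z_add: "z p q r \<otimes> z p' q' r' = z (p + p') (q + q') (r + r')"
proof -
  have comm: "x [^] (i::int) \<otimes> y [^] (j::int) = y [^] j \<otimes> x [^] i"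
    if "x \<otimes> y = y \<otimes> x" "x \<in> carrier G" "y \<in> carrier G" for x y i j
    by (intro commute_int_pow int_pow_closed that commute_int_pow[symmetric]) (simp add: that)
  have su': "u [^] r \<otimes> (s [^] p' \<otimes> x) = s [^] p' \<otimes> (u [^] r \<otimes> x)"
    and st': "t [^] q \<otimes> (s [^] p' \<otimes> x) = s [^] p' \<otimes> (t [^] q \<otimes> x)"
    and tu': "u [^] r \<otimes> (t [^] q' \<otimes> x) = t [^] q' \<otimes> (u [^] r \<otimes> x)" if "x \<in> carrier G" for x
    using comm[OF su, of p' r] comm[OF st, of p' q] comm[OF tu, of q' r] that
    by (simp_all flip: m_assoc)
  have "z p q r \<otimes> z p' q' r' =
      (s [^] p \<otimes> s [^] p') \<otimes> (t [^] q \<otimes> t [^] q') \<otimes> (u [^] r \<otimes> u [^] r')"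
    by (simp add: z_def m_assoc su' st' tu')
  also have "\<dots> = z (p + p') (q + q') (r + r')"
    by (simp add: z_def m_assoc int_pow_mult)
  finally show ?thesis .
qed

lemma z_0 [simp]: "z 0 0 0 = \<one>"
  by (simp add: z_def)

lemma z_gen: "z 1 0 0 = s" "z 0 1 0 = t" "z 0 0 1 = u"
  by (simp_all add: z_def)

lemma inv_z: "inv (z p q r) = z (- p) (- q) (- r)"
  by (rule inv_equality) (simp_all add: z_add)

lemma z_inv_gen: "z (- 1) 0 0 = inv s" "z 0 (- 1) 0 = inv t" "z 0 0 (- 1) = inv u"
  using inv_z[of 1 0 0] inv_z[of 0 1 0] inv_z[of 0 0 1] by (simp_all add: z_gen)

lemma z_z_closed: "x \<in> carrier G \<Longrightarrow>
    z p q r \<otimes> (z p' q' r' \<otimes> x) = z (p + p') (q + q') (r + r') \<otimes> x"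
  by (simp flip: m_assoc add: z_add)

text \<open>By \<open>a_u\<close>, \<open>u \<otimes> inv t\<close> commutes with \<open>a\<close>.
  Hence the exponents of \<open>t\<close> and \<open>u\<close> enter the position of a lamp only
  through their sum.\<close>

lemma z_diag_a: "z 0 (- k) k \<otimes> a = a \<otimes> z 0 (- k) k"
proof -
  let ?w = "z 0 (- 1) 1"
  have w: "?w = u \<otimes> inv t"
    using z_add[of 0 0 1 0 "- 1" 0] by (simp add: z_gen z_inv_gen)
  have "u \<otimes> inv t \<otimes> a = u \<otimes> (inv t \<otimes> a \<otimes> t) \<otimes> inv t"
    by (simp add: m_assoc)
  also have "\<dots> = a \<otimes> (u \<otimes> inv t)"
    by (simp flip: a_u) (simp flip: m_assoc)
  finally have 1: "?w \<otimes> a = a \<otimes> ?w"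
    by (simp add: w)
  have nat: "?w [^] n = z 0 (- int n) (int n)" for n :: nat
    by (induction n) (simp_all add: z_add add.commute)
  have "?w [^] k = z 0 (- k) k"
    using nat[of "nat k"] nat[of "nat (- k)"] by (auto simp: int_pow_def2 inv_z)
  then show ?thesis
    using commute_int_pow[OF _ _ 1, of k] by simp
qed

definition e :: "int \<Rightarrow> int \<Rightarrow> 'a" where
  "e i n = z i n 0 \<otimes> (a \<otimes> z (- i) (- n) 0)"

lemma e_closed [simp]: "e i n \<in> carrier G"
  by (simp add: e_def)

lemma e_0 [simp]: "e 0 0 = a"
  by (simp add: e_def)

lemma z_a: "z p q r \<otimes> a = e p (q + r) \<otimes> z p q r"
proof -
  have "z p q r \<otimes> a = z p (q + r) 0 \<otimes> (z 0 (- r) r \<otimes> a)"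
    by (simp flip: m_assoc add: z_add)
  also have "\<dots> = e p (q + r) \<otimes> z p q r"
    by (simp add: z_diag_a e_def m_assoc z_add)
  finally show ?thesis .
qed

lemma z_e: "z p q r \<otimes> e i n = e (p + i) (q + r + n) \<otimes> z p q r"
proof -
  have "z p q r \<otimes> e i n = z (p + i) (q + n) r \<otimes> a \<otimes> z (- i) (- n) 0"
    by (simp add: e_def m_assoc z_z_closed)
  also have "\<dots> = e (p + i) (q + r + n) \<otimes> z p q r"
    by (simp add: z_a m_assoc z_add algebra_simps)
  finally show ?thesis .
qed

lemma e_conj: "e (p + i) (q + n) = z p q 0 \<otimes> (e i n \<otimes> z (- p) (- q) 0)"
proof -
  have "z p q 0 \<otimes> (e i n \<otimes> z (- p) (- q) 0) = e (p + i) (q + n) \<otimes> (z p q 0 \<otimes> z (- p) (- q) 0)"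
    using z_e[of p q 0 i n] by (simp flip: m_assoc)
  then show ?thesis by (simp add: z_add)
qed

lemma e_mult_shift:
  "e (p + i) (q + n) \<otimes> e (p + i') (q + n') = z p q 0 \<otimes> (e i n \<otimes> e i' n' \<otimes> z (- p) (- q) 0)"
  by (simp add: e_conj m_assoc z_z_closed)

lemma e_e [simp]: "e i n \<otimes> e i n = \<one>"
  using e_mult_shift[of i 0 n 0 0 0] by (simp add: a_a z_add)

lemma inv_e [simp]: "inv (e i n) = e i n"
  by (rule inv_equality) simp_all

lemma inv_a [simp]: "inv a = a"
  using inv_e[of 0 0] by simp

text \<open>The relation \<open>a_s\<close> is the case \<open>i = n = 0\<close>; conjugation by
  \<open>z i n 0\<close> carries it everywhere.\<close>

lemma triangle: "e (i - 1) n = e i n \<otimes> e i (n - 1)"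
proof -
  have "e (- 1) 0 = inv s \<otimes> a \<otimes> s" "e 0 (- 1) = inv t \<otimes> a \<otimes> t"
    by (simp_all add: e_def z_inv_gen z_gen m_assoc)
  then have "e (- 1) 0 = e 0 0 \<otimes> e 0 (- 1)"
    by (simp add: a_s)
  then show ?thesis
    using e_conj[of i "- 1" n 0] e_mult_shift[of i 0 n 0 0 "- 1"] by simp
qed

lemma e_comm_shift:
  "e i n \<otimes> e i' n' = e i' n' \<otimes> e i n \<Longrightarrow>
    e (p + i) (q + n) \<otimes> e (p + i') (q + n') = e (p + i') (q + n') \<otimes> e (p + i) (q + n)"
  by (simp add: e_mult_shift)

text \<open>Baumslag's trick: conjugating \<open>[a, a\<^bsup>t^n\<^esup>] = 1\<close> by \<open>s\<close> yields \<open>[a, a\<^bsup>t^(n+1)\<^esup>] = 1\<close>.\<close>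

lemma a_comm_e: "a \<otimes> e 0 (- int n) = e 0 (- int n) \<otimes> a"
proof (induction n rule: less_induct)
  case (less n)
  consider "n = 0" | "n = 1" | k where "n = Suc (Suc k)"
    by (metis One_nat_def not0_implies_Suc)
  then show ?case
  proof cases
    case 1
    then show ?thesis by simp
  next
    case 2
    have "e 0 (- 1) = inv t \<otimes> a \<otimes> t"
      by (simp_all add: e_def z_inv_gen z_gen m_assoc)
    then show ?thesis using 2 a_at by simp
  next
    case 3
    \<comment> \<open>The products \<open>x \<otimes> y\<close> and \<open>w \<otimes> v\<close> are
      lamps of column -1 at distance \<open>k + 1\<close>, so they commute by induction. The mixed
      pairs other than \<open>x\<close>, \<open>v\<close> also commute by induction, and cancelling
      them leaves the claim for \<open>x\<close> and \<open>v\<close>.\<close>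
    define x y w v where "x = e 0 0" and "y = e 0 (- 1)" and "w = e 0 (- int k - 1)" and "v = e 0 (- int k - 2)"
    have ints: "- int (Suc k) = - int k - 1" "- int (Suc (Suc k)) = - int k - 2"
      "- 1 - int k = - int k - 1" "- 2 - int k = - int k - 2" "- 1 - (int k + 1) = - int k - 2"
      "- 1 - (- int k - 1) = int k" "- 1 + (- int k - 1) = - int k - 2"
      by simp_all
    have cl [simp]: "x \<in> carrier G" "y \<in> carrier G" "w \<in> carrier G" "v \<in> carrier G"
      by (simp_all only: x_def y_def w_def v_def e_closed)
    have xw: "x \<otimes> w = w \<otimes> x"
      using less.IH[of "Suc k"] 3 unfolding x_def w_def ints by simp
    have yw: "y \<otimes> w = w \<otimes> y"
      using e_comm_shift[of 0 0 0 "- int k" 0 "- 1"] less.IH[of k] 3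
      by (simp add: y_def w_def ints)
    have yv: "y \<otimes> v = v \<otimes> y"
      using e_comm_shift[of 0 0 0 "- int k - 1" 0 "- 1"] less.IH[of "Suc k"] 3
      by (simp add: y_def v_def ints)
    have xy: "x \<otimes> y = e (- 1) 0"
      using triangle[of 0 0] by (simp add: x_def y_def)
    have wv: "w \<otimes> v = e (- 1) (- int k - 1)"
      using triangle[of 0 "- int k - 1"] by (simp add: w_def v_def ints)
    have "w \<otimes> (x \<otimes> v \<otimes> y) = w \<otimes> x \<otimes> (y \<otimes> v)"
      by (simp add: m_assoc yv)
    also have "\<dots> = x \<otimes> (w \<otimes> y) \<otimes> v"
      by (simp flip: xw add: m_assoc)
    also have "\<dots> = (x \<otimes> y) \<otimes> (w \<otimes> v)"
      by (simp flip: yw add: m_assoc)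
    also have "\<dots> = (w \<otimes> v) \<otimes> (x \<otimes> y)"
      using e_comm_shift[of 0 0 0 "- int k - 1" "- 1" 0] less.IH[of "Suc k"] 3
      by (simp add: xy wv ints)
    also have "\<dots> = w \<otimes> (v \<otimes> x \<otimes> y)"
      by (simp add: m_assoc)
    finally have "x \<otimes> v = v \<otimes> x"
      by simp
    then show ?thesis
      unfolding 3 x_def v_def ints by simp
  qed
qed

text \<open>Translates of \<open>a_comm_e\<close> settle two lamps of column 0. The triangle
  relation writes a lamp of column -k-1 through two lamps of column -k, so induction on
  \<open>k\<close> compares every column further left with column 0, and a translation gives all
  pairs.\<close>

lemma e_comm: "e i n \<otimes> e i' n' = e i' n' \<otimes> e i n"
proof -
  have le: "e 0 n \<otimes> e 0 n' = e 0 n' \<otimes> e 0 n" if "n' \<le> n" for n n'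
    using e_comm_shift[of 0 0 0 "n' - n" 0 n] a_comm_e[of "nat (n - n')"] that by simp
  have 1: "e (- int k) n \<otimes> e 0 n' = e 0 n' \<otimes> e (- int k) n" for k n n'
  proof (induction k arbitrary: n)
    case 0
    then show ?case using le[of n n'] le[of n' n] by (cases "n \<le> n'") simp_all
  next
    case (Suc k)
    have *: "e (- int (Suc k)) n = e (- int k) n \<otimes> e (- int k) (n - 1)"
      using triangle[of "- int k" n] by (metis minus_add_distrib of_nat_Suc add.commute uminus_add_conv_diff)
    show ?case
      unfolding * using Suc[of n] Suc[of "n - 1"] by (simp add: m_assoc) (simp flip: m_assoc)
  qed
  have "e i n \<otimes> e i' n' = e i' n' \<otimes> e i n" if "i \<le> i'" for i i' n n'
    using e_comm_shift[OF 1[of "nat (i' - i)" n n'], of i' 0] that by simp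
  then show ?thesis by (metis linear)
qed

end

section \<open>Tours of the lamplighter\<close>

text \<open>The weight \<open>w\<close> is 1 for \<open>A\<close>. It is 2 for \<open>B\<close>,
  where a letter has a budget of 2 and a move by \<open>s\<close> uses all of it.\<close>

definition step_cost :: "int \<Rightarrow> int \<times> int \<Rightarrow> int \<times> int \<Rightarrow> int" where
  "step_cost w x y = w * \<bar>fst x - fst y\<bar> + \<bar>snd x - snd y\<bar>"

fun path_cost :: "int \<Rightarrow> (int \<times> int) list \<Rightarrow> int" where
  "path_cost w (x # y # zs) = step_cost w x y + path_cost w (y # zs)"
| "path_cost w _ = 0"

lemma step_cost_nonneg: "0 \<le> w \<Longrightarrow> 0 \<le> step_cost w x y"
  by (simp add: step_cost_def)

lemma path_cost_nonneg: "0 \<le> w \<Longrightarrow> 0 \<le> path_cost w xs"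
  by (induction w xs rule: path_cost.induct) (simp_all add: step_cost_nonneg)

lemma step_cost_triangle:
  assumes "0 \<le> w"
  shows "step_cost w x z \<le> step_cost w x y + step_cost w y z"
proof -
  have "w * \<bar>fst x - fst z\<bar> \<le> w * (\<bar>fst x - fst y\<bar> + \<bar>fst y - fst z\<bar>)"
    using assms by (intro mult_left_mono) auto
  then show ?thesis
    by (simp add: step_cost_def distrib_left)
qed

lemma path_cost_split: "path_cost w (xs @ x # ys) = path_cost w (xs @ [x]) + path_cost w (x # ys)"
proof (induction xs)
  case (Cons y xs)
  then show ?case by (cases xs) simp_all
qed simp

lemma path_cost_skip: "0 \<le> w \<Longrightarrow> path_cost w (xs @ ys) \<le> path_cost w (xs @ y # ys)"
proof (induction xs)
  case Nil
  then show ?case by (cases ys) (simp_all add: step_cost_nonneg)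
next
  case (Cons x xs)
  show ?case
  proof (cases xs)
    case Nil
    then show ?thesis
      using Cons.prems step_cost_triangle[of w x "hd ys" y]
      by (cases ys) (simp_all add: step_cost_nonneg)
  qed (use Cons in simp)
qed

lemma path_cost_append:
  "0 \<le> w \<Longrightarrow> path_cost w (x # xs @ ys @ [z]) \<le> path_cost w (x # xs @ [y]) + path_cost w (y # ys @ [z])"
  using path_cost_skip[of w "x # xs" "ys @ [z]" y] path_cost_split[of w "x # xs" y "ys @ [z]"]
  by simp

lemma path_cost_shift: "path_cost w (map (\<lambda>(i, n). (p + i, q + n)) xs) = path_cost w xs"
  by (induction w xs rule: path_cost.induct) (auto simp: step_cost_def)

lemma step_cost_le_path_cost:
  assumes "0 \<le> w" "l \<le> m" "m < length xs"
  shows "path_cost w (take (Suc l) xs) + step_cost w (xs ! l) (xs ! m) \<le> path_cost w (take (Suc m) xs)"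
  using assms(2,3)
proof (induction m rule: dec_induct)
  case base
  then show ?case by (simp add: step_cost_def)
next
  case (step m)
  have "take (Suc m) xs @ [xs ! Suc m] = take m xs @ xs ! m # [xs ! Suc m]"
    using step.prems by (simp add: take_Suc_conv_app_nth)
  then have "path_cost w (take (Suc (Suc m)) xs) =
      path_cost w (take (Suc m) xs) + step_cost w (xs ! m) (xs ! Suc m)"
    using step.prems path_cost_split[of w "take m xs" "xs ! m" "[xs ! Suc m]"]
    by (simp add: take_Suc_conv_app_nth)
  moreover have "step_cost w (xs ! l) (xs ! Suc m) \<le>
      step_cost w (xs ! l) (xs ! m) + step_cost w (xs ! m) (xs ! Suc m)"
    using assms(1) by (rule step_cost_triangle)
  ultimately show ?case
    using step by simp
qed

text \<open>Sorting the positions of the three points in the list splits the path into four legs.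
  The order found stays hidden in the set equality; the later estimates treat the three points
  alike.\<close>

lemma ordered_waypoints:
  assumes w: "0 \<le> w" and "x \<in> set xs" "y \<in> set xs" "z \<in> set xs"
  obtains p1 p2 p3 where "{p1, p2, p3} = {x, y, z}"
    "step_cost w (hd xs) p1 + step_cost w p1 p2 + step_cost w p2 p3 + step_cost w p3 (last xs)
      \<le> path_cost w xs"
proof -
  have *: "step_cost w (hd xs) (xs ! k) + step_cost w (xs ! k) (xs ! l) + step_cost w (xs ! l) (xs ! m)
      + step_cost w (xs ! m) (last xs) \<le> path_cost w xs"
    if "k \<le> l" "l \<le> m" "m < length xs" for k l m
  proof -
    have "path_cost w (take (Suc 0) xs) = 0"
      by (cases xs) simp_all
    moreover have "m \<le> length xs - 1" "length xs - 1 < length xs"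
      using that(3) by linarith+
    moreover have "xs \<noteq> []"
      using that by auto
    then have "hd xs = xs ! 0" "last xs = xs ! (length xs - 1)" "take (Suc (length xs - 1)) xs = xs"
      by (simp_all add: hd_conv_nth last_conv_nth)
    ultimately show ?thesis
      using that step_cost_le_path_cost[of w 0 k xs] step_cost_le_path_cost[of w k l xs]
        step_cost_le_path_cost[of w l m xs] step_cost_le_path_cost[of w m "length xs - 1" xs] w
      by auto
  qed
  obtain k l m where klm: "xs ! k = x" "k < length xs" "xs ! l = y" "l < length xs"
    "xs ! m = z" "m < length xs"
    using assms(2-4) by (metis in_set_conv_nth)
  consider "k \<le> l" "l \<le> m" | "k \<le> m" "m \<le> l" | "l \<le> k" "k \<le> m" | "l \<le> m" "m \<le> k"
    | "m \<le> k" "k \<le> l" | "m \<le> l" "l \<le> k"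
    by linarith
  then show thesis
  proof cases
    case 1 show thesis by (rule that[of x y z]) (use *[OF 1] klm in auto)
  next
    case 2 show thesis by (rule that[of x z y]) (use *[OF 2] klm in auto)
  next
    case 3 show thesis by (rule that[of y x z]) (use *[OF 3] klm in auto)
  next
    case 4 show thesis by (rule that[of y z x]) (use *[OF 4] klm in auto)
  next
    case 5 show thesis by (rule that[of z x y]) (use *[OF 5] klm in auto)
  next
    case 6 show thesis by (rule that[of z y x]) (use *[OF 6] klm in auto)
  qed
qed

context group
begin

definition symm :: "'a set \<Rightarrow> 'a set" where
  "symm S = S \<union> m_inv G ` S"

lemma symm_closed: "S \<subseteq> carrier G \<Longrightarrow> symm S \<subseteq> carrier G"
  by (auto simp: symm_def)

end

context baumslag
begin

definition lamps :: "(int \<times> int) list \<Rightarrow> 'a" where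
  "lamps xs = foldr (\<lambda>(i, n) g. e i n \<otimes> g) xs \<one>"

lemma lamps_simps [simp]: "lamps [] = \<one>" "lamps ((i, n) # xs) = e i n \<otimes> lamps xs"
  by (simp_all add: lamps_def)

lemma lamps_closed [simp]: "lamps xs \<in> carrier G"
  by (induction xs) (auto simp: lamps_def)

lemma lamps_append: "lamps (xs @ ys) = lamps xs \<otimes> lamps ys"
  by (induction xs) (auto simp: m_assoc)

lemma z_lamps:
  "z p q r \<otimes> lamps xs = lamps (map (\<lambda>(i, n). (p + i, q + r + n)) xs) \<otimes> z p q r"
proof (induction xs)
  case (Cons x xs)
  obtain i n where x: "x = (i, n)" by force
  have "z p q r \<otimes> lamps (x # xs) = e (p + i) (q + r + n) \<otimes> (z p q r \<otimes> lamps xs)"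
    using z_e[of p q r i n] by (simp add: x flip: m_assoc)
  then show ?case
    by (simp add: x Cons m_assoc)
qed simp

text \<open>\<open>xs\<close> lists the switched lamps in the order of the visits. The cost
  \<open>c\<close> is only an upper bound, so that the costs of factors simply add up.\<close>

definition tour :: "int \<Rightarrow> 'a \<Rightarrow> (int \<times> int) list \<Rightarrow> int \<Rightarrow> int \<Rightarrow> int \<Rightarrow> int \<Rightarrow> bool" where
  "tour w g xs p q r c \<longleftrightarrow>
    g = lamps xs \<otimes> z p q r \<and> path_cost w ((0, 0) # xs @ [(p, q + r)]) \<le> c"

text \<open>The second tour is translated to the end of the first. The combined path no longer stops
  at the junction, which cannot make it longer.\<close>

lemma tour_mult:
  assumes "0 \<le> w" "tour w g xs p q r c" "tour w g' xs' p' q' r' c'"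
  shows "tour w (g \<otimes> g') (xs @ map (\<lambda>(i, n). (p + i, q + r + n)) xs')
    (p + p') (q + q') (r + r') (c + c')"
proof -
  let ?f = "\<lambda>(i, n). (p + i, q + r + n)"
  have "g \<otimes> g' = lamps xs \<otimes> (z p q r \<otimes> lamps xs') \<otimes> z p' q' r'"
    using assms by (simp add: tour_def m_assoc)
  also have "\<dots> = lamps (xs @ map ?f xs') \<otimes> z (p + p') (q + q') (r + r')"
    by (simp add: z_lamps lamps_append m_assoc z_add)
  finally have g: "g \<otimes> g' = \<dots>" .
  have "path_cost w (map ?f ((0, 0) # xs' @ [(p', q' + r')])) \<le> c'"
    unfolding path_cost_shift using assms by (simp add: tour_def)
  then have "path_cost w ((p, q + r) # map ?f xs' @ [(p + p', q + r + (q' + r'))]) \<le> c'"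
    by simp
  then show ?thesis
    using g assms path_cost_append[of w "(0, 0)" xs "map ?f xs'" "(p + p', q + r + (q' + r'))" "(p, q + r)"]
    by (simp add: tour_def algebra_simps)
qed

text \<open>Unlike \<open>c\<close>, the difference \<open>d\<close> is exact. The path sees only
  \<open>q + r\<close>, so \<open>d\<close> is carried along separately.\<close>

definition bounded_tour :: "int \<Rightarrow> 'a \<Rightarrow> int \<Rightarrow> int \<Rightarrow> bool" where
  "bounded_tour w g c d \<longleftrightarrow> (\<exists>xs p q r. tour w g xs p q r c \<and> d = q - r)"

lemma bounded_tour_mult:
  "0 \<le> w \<Longrightarrow> bounded_tour w g c d \<Longrightarrow> bounded_tour w g' c' d' \<Longrightarrow>
    bounded_tour w (g \<otimes> g') (c + c') (d + d')"
  unfolding bounded_tour_def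
  by (elim exE conjE, intro exI conjI, erule (2) tour_mult, simp)

lemma bounded_tour_z: "bounded_tour w (z p q r) (step_cost w (0, 0) (p, q + r)) (q - r)"
  unfolding bounded_tour_def tour_def
  by (intro exI[of _ "[]"] exI[of _ p] exI[of _ q] exI[of _ r]) simp

lemma bounded_tour_a: "bounded_tour w a 0 0"
  unfolding bounded_tour_def tour_def
  by (intro exI[of _ "[(0, 0)]"] exI[of _ 0]) (simp add: step_cost_def)

lemma bounded_tour_one: "bounded_tour w \<one> 0 0"
  using bounded_tour_z[of w 0 0 0] by (simp add: step_cost_def)

lemma bounded_tour_gen:
  "bounded_tour w s w 0" "bounded_tour w (inv s) w 0"
  "bounded_tour w t 1 1" "bounded_tour w (inv t) 1 (- 1)"
  "bounded_tour w u 1 (- 1)" "bounded_tour w (inv u) 1 1"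
  "bounded_tour w (u \<otimes> inv t) 0 (- 2)" "bounded_tour w (t \<otimes> inv u) 0 2"
  if "0 \<le> w"
  using that bounded_tour_z[of w 1 0 0] bounded_tour_z[of w "- 1" 0 0]
    bounded_tour_z[of w 0 1 0] bounded_tour_z[of w 0 "- 1" 0]
    bounded_tour_z[of w 0 0 1] bounded_tour_z[of w 0 0 "- 1"]
    bounded_tour_z[of w 0 "- 1" 1] bounded_tour_z[of w 0 1 "- 1"]
    z_add[of 0 0 1 0 "- 1" 0] z_add[of 0 1 0 0 0 "- 1"]
  by (simp_all add: z_gen z_inv_gen step_cost_def)

text \<open>The right-nested product hides the factor \<open>t \<otimes> inv u\<close>. Multiplying
  letter by letter would charge 2 for a move that does not leave the lamp.\<close>

lemma bounded_tour_diag_a: "0 \<le> w \<Longrightarrow> bounded_tour w (t \<otimes> (inv u \<otimes> a)) 0 2"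
  using bounded_tour_mult[OF _ bounded_tour_gen(8) bounded_tour_a] by (simp add: m_assoc)

section \<open>Letters of the two generating sets and their costs\<close>

definition A :: "'a set" where
  "A = {a, s, t, u, a \<otimes> s, a \<otimes> t, a \<otimes> u, s \<otimes> a, t \<otimes> a, u \<otimes> a,
    a \<otimes> (s \<otimes> a), a \<otimes> (t \<otimes> a), a \<otimes> (u \<otimes> a)}"

definition B :: "'a set" where
  "B = A \<union> {t \<otimes> u, a \<otimes> (t \<otimes> u), t \<otimes> (a \<otimes> u), t \<otimes> (u \<otimes> a), a \<otimes> (t \<otimes> (a \<otimes> u)),
    a \<otimes> (t \<otimes> (u \<otimes> a)), t \<otimes> (a \<otimes> (u \<otimes> a)), a \<otimes> (t \<otimes> (a \<otimes> (u \<otimes> a))),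
    u \<otimes> inv t, a \<otimes> (u \<otimes> inv t), t \<otimes> (a \<otimes> inv t), inv t \<otimes> (a \<otimes> t),
    a \<otimes> (t \<otimes> (a \<otimes> inv t)), a \<otimes> (inv t \<otimes> (a \<otimes> t))}"

lemma A_closed: "A \<subseteq> carrier G" and B_closed: "B \<subseteq> carrier G"
  by (auto simp: A_def B_def)

lemma symm_A: "symm A = {a, s, t, u, a \<otimes> s, a \<otimes> t, a \<otimes> u, s \<otimes> a, t \<otimes> a, u \<otimes> a,
    a \<otimes> (s \<otimes> a), a \<otimes> (t \<otimes> a), a \<otimes> (u \<otimes> a), inv s, inv t, inv u,
    a \<otimes> inv s, a \<otimes> inv t, a \<otimes> inv u, inv s \<otimes> a, inv t \<otimes> a, inv u \<otimes> a,
    a \<otimes> (inv s \<otimes> a), a \<otimes> (inv t \<otimes> a), a \<otimes> (inv u \<otimes> a)}"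
  by (simp add: symm_def A_def inv_mult_group m_assoc) blast

lemma symm_B: "symm B = symm A \<union> {t \<otimes> u, a \<otimes> (t \<otimes> u), t \<otimes> (a \<otimes> u), t \<otimes> (u \<otimes> a),
    a \<otimes> (t \<otimes> (a \<otimes> u)), a \<otimes> (t \<otimes> (u \<otimes> a)), t \<otimes> (a \<otimes> (u \<otimes> a)), a \<otimes> (t \<otimes> (a \<otimes> (u \<otimes> a))),
    u \<otimes> inv t, a \<otimes> (u \<otimes> inv t), t \<otimes> (a \<otimes> inv t), inv t \<otimes> (a \<otimes> t),
    a \<otimes> (t \<otimes> (a \<otimes> inv t)), a \<otimes> (inv t \<otimes> (a \<otimes> t)),
    inv u \<otimes> inv t, inv u \<otimes> (inv t \<otimes> a), inv u \<otimes> (a \<otimes> inv t), a \<otimes> (inv u \<otimes> inv t),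
    inv u \<otimes> (a \<otimes> (inv t \<otimes> a)), a \<otimes> (inv u \<otimes> (inv t \<otimes> a)), a \<otimes> (inv u \<otimes> (a \<otimes> inv t)),
    a \<otimes> (inv u \<otimes> (a \<otimes> (inv t \<otimes> a))),
    t \<otimes> inv u, t \<otimes> (inv u \<otimes> a), t \<otimes> (a \<otimes> (inv t \<otimes> a)), inv t \<otimes> (a \<otimes> (t \<otimes> a))}"
  by (simp add: symm_def B_def image_Un inv_mult_group m_assoc) blast

text \<open>The bound on \<open>d\<close> will keep \<open>q\<close> and \<open>r\<close> small
  separately, where the cost controls only their sum.\<close>

lemma symm_A_tour: "\<forall>x\<in>symm A. \<exists>c d. bounded_tour 1 x c d \<and> c \<le> 1 \<and> \<bar>d\<bar> \<le> 1"
  unfolding symm_A ball_simps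
  by (intro conjI TrueI,
      (rule exI, rule exI, rule conjI,
        (rule bounded_tour_mult bounded_tour_a bounded_tour_gen zero_le_one)+, simp)+)

text \<open>Cost and \<open>d\<close> contribute 2 + 0 for \<open>s\<close>,
  \<open>t \<otimes> u\<close> and the conjugates of \<open>a\<close> by \<open>t\<close>, 1 + 1 for
  \<open>t\<close> and \<open>u\<close>, and 0 + 2 for \<open>u \<otimes> inv t\<close>; factors
  \<open>a\<close> are free.\<close>

lemma symm_B_tour: "\<forall>x\<in>symm B. \<exists>c d. bounded_tour 2 x c d \<and> c + \<bar>d\<bar> \<le> 2"
  unfolding symm_B symm_A ball_simps ball_Un
  by (intro conjI TrueI,
      (rule exI, rule exI, rule conjI,
        (rule bounded_tour_gen(7,8) bounded_tour_diag_a bounded_tour_mult bounded_tour_a bounded_tour_gen zero_le_numeral)+, simp)+)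

end

section \<open>Balls, and the lamps along a path\<close>

context group
begin

definition ball :: "'a set \<Rightarrow> nat \<Rightarrow> 'a set" where
  "ball S n = {foldr (\<otimes>) ws \<one> | ws. set ws \<subseteq> symm S \<and> length ws \<le> n}"

lemma foldr_mult_closed: "set ws \<subseteq> carrier G \<Longrightarrow> foldr (\<otimes>) ws \<one> \<in> carrier G"
  by (induction ws) auto

lemma ball_closed: "S \<subseteq> carrier G \<Longrightarrow> ball S n \<subseteq> carrier G"
  using symm_closed[of S] by (auto simp: ball_def intro!: foldr_mult_closed)

lemma ball_mono: "m \<le> n \<Longrightarrow> ball S m \<subseteq> ball S n"
  by (force simp: ball_def)

lemma foldr_mult_snoc:
  "set ws \<subseteq> carrier G \<Longrightarrow> x \<in> carrier G \<Longrightarrow>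
    foldr (\<otimes>) (ws @ [x]) \<one> = foldr (\<otimes>) ws \<one> \<otimes> x"
  by (induction ws) (auto simp: m_assoc foldr_mult_closed simp del: foldr_append)

lemma one_in_ball: "\<one> \<in> ball S n"
  by (auto simp: ball_def intro: exI[of _ "[]"])

lemma ball_mult:
  assumes "S \<subseteq> carrier G" "g \<in> ball S n" "x \<in> insert \<one> (symm S)"
  shows "g \<otimes> x \<in> ball S (Suc n)"
proof (cases "x = \<one>")
  case True
  then show ?thesis
    using assms ball_closed[of S n] ball_mono[of n "Suc n" S] by (metis lessI less_imp_le r_one subsetD)
next
  case False
  obtain ws where ws: "g = foldr (\<otimes>) ws \<one>" "set ws \<subseteq> symm S" "length ws \<le> n"
    using assms by (auto simp: ball_def)
  have "g \<otimes> x = foldr (\<otimes>) (ws @ [x]) \<one>"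
    using ws(1,2) False assms symm_closed[of S] by (subst foldr_mult_snoc) auto
  then show ?thesis
    unfolding ball_def using ws False assms(3) by (intro CollectI exI[of _ "ws @ [x]"]) simp
qed

text \<open>The inverse of \<open>c\<close> merges with the first letter of a word for
  \<open>c \<otimes> g\<close>. If that word is empty, \<open>g\<close> is the single letter
  \<open>inv c\<close>, which is why the radius must be positive.\<close>

lemma ball_absorb:
  assumes S: "S \<subseteq> carrier G" "c \<in> S" "\<And>x. x \<in> symm S \<Longrightarrow> inv c \<otimes> x \<in> insert \<one> (symm S)"
    and g: "g \<in> carrier G" "c \<otimes> g \<in> ball S n" "1 \<le> n"
  shows "g \<in> ball S n"
proof -
  obtain ws where ws: "c \<otimes> g = foldr (\<otimes>) ws \<one>" "set ws \<subseteq> symm S" "length ws \<le> n"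
    using g by (auto simp: ball_def)
  have c: "c \<in> carrier G" using S by auto
  have g': "g = inv c \<otimes> foldr (\<otimes>) ws \<one>"
    using c g by (simp flip: ws(1) m_assoc)
  show ?thesis
  proof (cases ws)
    case Nil
    then have "g = foldr (\<otimes>) [inv c] \<one>"
      using g' by simp
    moreover have "inv c \<in> symm S"
      using S by (simp add: symm_def)
    ultimately show ?thesis
      unfolding ball_def using g(3) by (intro CollectI exI[of _ "[inv c]"]) simp
  next
    case (Cons x vs)
    have x: "x \<in> carrier G" "x \<in> symm S" "set vs \<subseteq> symm S" and vs: "set vs \<subseteq> carrier G"
      using symm_closed[OF S(1)] ws(2) Cons by auto
    then have "g = foldr (\<otimes>) ((inv c \<otimes> x) # vs) \<one>"
      using c by (simp add: g' Cons m_assoc foldr_mult_closed)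
    moreover have "inv c \<otimes> x \<in> insert \<one> (symm S)"
      using S(3) x by blast
    moreover have "foldr (\<otimes>) (\<one> # vs) \<one> = foldr (\<otimes>) vs \<one>"
      using vs by (simp add: foldr_mult_closed)
    ultimately consider "g = foldr (\<otimes>) vs \<one>" |
      "g = foldr (\<otimes>) ((inv c \<otimes> x) # vs) \<one>" "inv c \<otimes> x \<in> symm S"
      by auto
    then show ?thesis
    proof cases
      case 1
      with ws Cons x(3) show ?thesis
        unfolding ball_def by (intro CollectI exI[of _ vs]) simp
    next
      case 2
      with ws Cons x(3) show ?thesis
        unfolding ball_def by (intro CollectI exI[of _ "(inv c \<otimes> x) # vs"]) simp
    qed
  qed
qed

text \<open>Trades distances for balls; the infimum of a nonempty set in \<open>enat\<close> is
  attained.\<close>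

lemma word_dist_le_iff:
  "word_dist G S g h \<le> enat n \<longleftrightarrow> inv g \<otimes> h \<in> ball S n"
proof -
  define D where "D = {enat (length ws) | ws. set ws \<subseteq> symm S \<and> foldr (\<otimes>) ws \<one> = inv g \<otimes> h}"
  have D: "word_dist G S g h = Inf D"
    by (simp add: word_dist_def D_def symm_def)
  have "inv g \<otimes> h \<in> ball S n \<longleftrightarrow> (\<exists>d\<in>D. d \<le> enat n)"
  proof -
    have "inv g \<otimes> h \<in> ball S n \<longleftrightarrow>
        (\<exists>ws. set ws \<subseteq> symm S \<and> length ws \<le> n \<and> foldr (\<otimes>) ws \<one> = inv g \<otimes> h)"
      unfolding ball_def by (simp only: mem_Collect_eq) metis
    also have "\<dots> \<longleftrightarrow> (\<exists>d\<in>D. d \<le> enat n)"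
      unfolding D_def Bex_def mem_Collect_eq by (metis enat_ord_simps(1))
    finally show ?thesis .
  qed
  moreover have "(\<exists>d\<in>D. d \<le> enat n) \<longleftrightarrow> Inf D \<le> enat n"
  proof
    assume *: "Inf D \<le> enat n"
    then have "D \<noteq> {}"
      by (auto simp: Inf_enat_def)
    then have "Inf D \<in> D"
      unfolding Inf_enat_def by (auto intro: LeastI)
    with * show "\<exists>d\<in>D. d \<le> enat n" ..
  qed (meson Inf_lower order_trans)
  ultimately show ?thesis
    by (simp add: D)
qed

lemma generate_ball:
  assumes "S \<subseteq> carrier G" "g \<in> generate G S"
  shows "\<exists>n. g \<in> ball S n"
proof -
  have step: "\<exists>n. g \<otimes> x \<in> ball S n" if "\<exists>n. g \<in> ball S n" "x \<in> generate G S" for g x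
    using that(2,1)
  proof (induction arbitrary: g)
    case one
    then show ?case using ball_closed[OF assms(1)] by fastforce
  next
    case (incl x)
    then have "x \<in> insert \<one> (symm S)" by (simp add: symm_def)
    then show ?case using ball_mult[OF assms(1)] incl.prems by blast
  next
    case (inv x)
    then have "inv x \<in> insert \<one> (symm S)" by (simp add: symm_def)
    then show ?case using ball_mult[OF assms(1)] inv.prems by blast
  next
    case (eng x y)
    have "g \<otimes> (x \<otimes> y) = g \<otimes> x \<otimes> y"
      using eng.hyps eng.prems ball_closed[OF assms(1)] generate_in_carrier[OF assms(1)]
      by (metis m_assoc subsetD)
    then show ?case using eng.IH eng.prems by metis
  qed
  have "\<exists>n. \<one> \<otimes> g \<in> ball S n"
    by (rule step) (use assms one_in_ball in auto)
  then show ?thesis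
    using assms generate_in_carrier by auto
qed

end

context baumslag
begin

lemma ball_A_tour:
  assumes "g \<in> ball A n"
  shows "\<exists>c d. bounded_tour 1 g c d \<and> c \<le> int n \<and> \<bar>d\<bar> \<le> int n"
proof -
  have "\<exists>c d. bounded_tour 1 (foldr (\<otimes>) ws \<one>) c d \<and> c \<le> int (length ws) \<and> \<bar>d\<bar> \<le> int (length ws)"
    if "set ws \<subseteq> symm A" for ws
    using that
  proof (induction ws)
    case Nil
    then show ?case
      using bounded_tour_one[of 1] by (intro exI[of _ 0]) simp
  next
    case (Cons x ws)
    then obtain c d where cd: "bounded_tour 1 (foldr (\<otimes>) ws \<one>) c d" "c \<le> int (length ws)" "\<bar>d\<bar> \<le> int (length ws)"
      by auto
    obtain c' d' where cd': "bounded_tour 1 x c' d'" "c' \<le> 1" "\<bar>d'\<bar> \<le> 1"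
      using symm_A_tour Cons.prems by force
    show ?case
      using bounded_tour_mult[OF _ cd'(1) cd(1)] cd cd'
      by (intro exI[of _ "c' + c"] exI[of _ "d' + d"]) auto
  qed
  with assms show ?thesis
    unfolding ball_def by force
qed

lemma ball_B_tour:
  assumes "g \<in> ball B n"
  shows "\<exists>c d. bounded_tour 2 g c d \<and> c + \<bar>d\<bar> \<le> 2 * int n"
proof -
  have "\<exists>c d. bounded_tour 2 (foldr (\<otimes>) ws \<one>) c d \<and> c + \<bar>d\<bar> \<le> 2 * int (length ws)"
    if "set ws \<subseteq> symm B" for ws
    using that
  proof (induction ws)
    case Nil
    then show ?case
      using bounded_tour_one[of 2] by (intro exI[of _ 0]) simp
  next
    case (Cons x ws)
    then obtain c d where cd: "bounded_tour 2 (foldr (\<otimes>) ws \<one>) c d" "c + \<bar>d\<bar> \<le> 2 * int (length ws)"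
      by auto
    obtain c' d' where cd': "bounded_tour 2 x c' d'" "c' + \<bar>d'\<bar> \<le> 2"
      using symm_B_tour Cons.prems by force
    show ?case
      using bounded_tour_mult[OF _ cd'(1) cd(1)] cd cd'
      by (intro exI[of _ "c' + c"] exI[of _ "d' + d"]) auto
  qed
  with assms show ?thesis
    unfolding ball_def by force
qed

section \<open>Triangles of lamps and the groups they generate\<close>

definition corner_triangle :: "int \<Rightarrow> int \<Rightarrow> int \<Rightarrow> (int \<times> int) set" where
  "corner_triangle \<alpha> \<beta> \<gamma> = {(i, n). n \<le> \<alpha> \<and> i \<le> \<beta> \<and> - \<gamma> \<le> i + n}"

definition lamp_group :: "(int \<times> int) set \<Rightarrow> 'a set" where
  "lamp_group V = generate G ((\<lambda>(i, n). e i n) ` V)"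

lemma lamp_group_subgroup: "subgroup (lamp_group V) G"
  unfolding lamp_group_def by (rule generate_is_subgroup) auto

lemma e_in_lamp_group: "(i, n) \<in> V \<Longrightarrow> e i n \<in> lamp_group V"
  unfolding lamp_group_def by (rule generate.incl) force

lemma lamp_group_closed: "x \<in> lamp_group V \<Longrightarrow> x \<in> carrier G"
  using subgroup.subset[OF lamp_group_subgroup] by blast

lemma lamp_group_mult: "x \<in> lamp_group V \<Longrightarrow> y \<in> lamp_group V \<Longrightarrow> x \<otimes> y \<in> lamp_group V"
  by (rule subgroup.m_closed[OF lamp_group_subgroup])

lemma lamps_in_lamp_group: "set xs \<subseteq> V \<Longrightarrow> lamps xs \<in> lamp_group V"
proof (induction xs)
  case Nil
  then show ?case by (simp add: subgroup.one_closed[OF lamp_group_subgroup])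
next
  case (Cons x xs)
  then show ?case
    by (cases x) (auto intro!: lamp_group_mult e_in_lamp_group)
qed

lemma lamp_group_comm: "x \<in> lamp_group V \<Longrightarrow> x \<otimes> e i n = e i n \<otimes> x"
  unfolding lamp_group_def
proof (induction rule: generate.induct)
  case (incl h)
  then show ?case by (auto simp: e_comm)
next
  case (inv h)
  then show ?case by (auto simp: e_comm)
next
  case (eng x y)
  have cl: "x \<in> carrier G" "y \<in> carrier G"
    using eng.hyps lamp_group_closed[of _ V] by (simp_all add: lamp_group_def)
  have "x \<otimes> y \<otimes> e i n = x \<otimes> (y \<otimes> e i n)"
    using cl by (simp add: m_assoc)
  also have "\<dots> = x \<otimes> e i n \<otimes> y"
    using cl by (simp only: eng.IH(2) m_assoc e_closed)
  also have "\<dots> = e i n \<otimes> x \<otimes> y"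
    using eng.IH by simp
  finally show ?case
    using cl by (simp add: m_assoc)
qed simp

text \<open>Lamps are commuting involutions, so adjoining \<open>e i n\<close> to
  \<open>lamp_group V\<close> adds at most one coset.\<close>

lemma lamp_group_insert:
  assumes V: "\<And>j k. (j, k) \<in> W \<Longrightarrow> e j k \<in> lamp_group V \<or> e j k \<otimes> e i n \<in> lamp_group V"
    and "m \<in> lamp_group W"
  shows "\<exists>m'\<in>lamp_group V. m = m' \<or> m = m' \<otimes> e i n"
proof -
  have incl': "\<exists>m'\<in>lamp_group V. e j k = m' \<or> e j k = m' \<otimes> e i n" if "(j, k) \<in> W" for j k
  proof (cases "e j k \<in> lamp_group V")
    case False
    then have "e j k \<otimes> e i n \<in> lamp_group V" using V that by blast
    moreover have "e j k = e j k \<otimes> e i n \<otimes> e i n" by (simp add: m_assoc)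
    ultimately show ?thesis by metis
  qed auto
  show ?thesis
    using assms(2) unfolding lamp_group_def[of W]
  proof (induction rule: generate.induct)
    case one
    then show ?case using subgroup.one_closed[OF lamp_group_subgroup] by blast
  next
    case (incl h)
    then show ?case using incl' by auto
  next
    case (inv h)
    then show ?case using incl' by auto
  next
    case (eng x y)
    then obtain x' y' where x': "x' \<in> lamp_group V" "x = x' \<or> x = x' \<otimes> e i n"
      and y': "y' \<in> lamp_group V" "y = y' \<or> y = y' \<otimes> e i n"
      by blast
    have cl: "x' \<in> carrier G" "y' \<in> carrier G"
      using x' y' lamp_group_closed by auto
    have e: "x' \<otimes> e i n \<otimes> y' = x' \<otimes> y' \<otimes> e i n"
      using lamp_group_comm[OF y'(1)] cl by (simp add: m_assoc)
    have "x' \<otimes> e i n \<otimes> (y' \<otimes> e i n) = x' \<otimes> e i n \<otimes> y' \<otimes> e i n"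
      using cl by (simp add: m_assoc)
    also have "\<dots> = x' \<otimes> y'"
      unfolding e using cl by (simp add: m_assoc)
    finally have "x \<otimes> y = x' \<otimes> y' \<or> x \<otimes> y = x' \<otimes> y' \<otimes> e i n"
      using x'(2) y'(2) e cl by (auto simp: m_assoc)
    then show ?case
      using lamp_group_mult[OF x'(1) y'(1)] by blast
  qed
qed

text \<open>Inserting squares of the intermediate involutions turns \<open>f j \<otimes> f k\<close>
  into a product of neighbouring pairs.\<close>

lemma telescope:
  assumes f: "\<And>j. lo \<le> j \<Longrightarrow> j < hi \<Longrightarrow> f j \<otimes> f (j + 1) \<in> lamp_group V"
    and inv: "\<And>j. f j \<in> carrier G" "\<And>j. f j \<otimes> f j = \<one>"
    and j: "lo \<le> j" "j \<le> hi" "lo \<le> k" "k \<le> hi"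
  shows "f j \<otimes> f (k :: int) \<in> lamp_group V"
proof -
  have up: "f j \<otimes> f k \<in> lamp_group V" if "j \<le> k" "lo \<le> j" "k \<le> hi" for j k
    using that
  proof (induction k rule: int_ge_induct)
    case base
    then show ?case by (simp add: inv subgroup.one_closed[OF lamp_group_subgroup])
  next
    case (step k)
    have "f j \<otimes> f (k + 1) = f j \<otimes> (f k \<otimes> f k) \<otimes> f (k + 1)"
      by (simp add: inv)
    also have "\<dots> = (f j \<otimes> f k) \<otimes> (f k \<otimes> f (k + 1))"
      by (simp only: inv(1) m_assoc m_closed)
    finally show ?case
      using step f[of k] by (simp add: lamp_group_mult)
  qed
  have "f j = inv (f j)" for j
    by (rule inv_equality[symmetric]) (simp_all add: inv)
  then have "inv (f k \<otimes> f j) = f j \<otimes> f k"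
    using inv by (metis inv_mult_group)
  then show ?thesis
    using up[of j k] up[of k j] j subgroup.m_inv_closed[OF lamp_group_subgroup, of "f k \<otimes> f j" V]
    by (cases "j \<le> k") auto
qed

text \<open>A unit step enlarges the bounding triangle of a path by at most one row, and within this row
  neighbouring lamps differ by a lamp of the smaller triangle.\<close>

lemma lamp_group_step:
  assumes inside: "(i, n) \<in> corner_triangle \<alpha> \<beta> \<gamma>" and adj: "\<bar>i' - i\<bar> + \<bar>n' - n\<bar> \<le> 1"
    and m: "m \<in> lamp_group (corner_triangle (max \<alpha> n') (max \<beta> i') (max \<gamma> (- (i' + n'))))"
  shows "\<exists>m'\<in>lamp_group (corner_triangle \<alpha> \<beta> \<gamma>). m = m' \<or> m = m' \<otimes> e i' n'"
proof (rule lamp_group_insert[OF _ m])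
  let ?T = "corner_triangle \<alpha> \<beta> \<gamma>"
  fix j k
  assume jk: "(j, k) \<in> corner_triangle (max \<alpha> n') (max \<beta> i') (max \<gamma> (- (i' + n')))"
  have cancel: "e j k \<otimes> (e j k \<otimes> e j' k') = e j' k'" for j k j' k'
    by (simp flip: m_assoc)
  \<comment> \<open>A unit step from inside moves at most one side of the triangle, by exactly one,
    and then \<open>(i', n')\<close> lies on the new side. The cases are an old lamp, or a lamp on a
    new upper, right or lower left side.\<close>
  consider "(j, k) \<in> ?T" | "k = \<alpha> + 1" "n' = \<alpha> + 1" "i' \<le> \<beta>" "- \<gamma> \<le> i' + n'"
    | "j = \<beta> + 1" "i' = \<beta> + 1" "n' \<le> \<alpha>" "- \<gamma> \<le> i' + n'"
    | "j + k = - \<gamma> - 1" "i' + n' = - \<gamma> - 1" "n' \<le> \<alpha>" "i' \<le> \<beta>"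
    using inside adj jk by (auto simp: corner_triangle_def max_def split: if_splits; linarith)
  then show "e j k \<in> lamp_group ?T \<or> e j k \<otimes> e i' n' \<in> lamp_group ?T"
  proof cases
    case 1
    then show ?thesis using e_in_lamp_group by blast
  next
    case 2
    have "e j k \<otimes> e i' k \<in> lamp_group ?T"
    \<comment> \<open>\<open>lo\<close> and \<open>hi\<close> are the ends of the new side. Two
      neighbours on it multiply, by the triangle relation, to a lamp of the old triangle. The other
      two sides are treated likewise.\<close>
    proof (rule telescope[where lo = "- \<gamma> - \<alpha> - 1" and hi = \<beta> and f = "\<lambda>j. e j k"])
      fix x assume "- \<gamma> - \<alpha> - 1 \<le> x" "x < \<beta>"
      then have "(x + 1, k - 1) \<in> ?T"
        using 2 by (auto simp: corner_triangle_def)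
      moreover have "e x k \<otimes> e (x + 1) k = e (x + 1) (k - 1)"
        using triangle[of "x + 1" k] e_comm[of x k "x + 1" k] cancel by simp
      ultimately show "e x k \<otimes> e (x + 1) k \<in> lamp_group ?T"
        using e_in_lamp_group by simp
    qed (use 2 jk in \<open>auto simp: corner_triangle_def max_def split: if_splits\<close>)
    then show ?thesis using 2 by simp
  next
    case 3
    have "e j k \<otimes> e j n' \<in> lamp_group ?T"
    proof (rule telescope[where lo = "- \<gamma> - \<beta> - 1" and hi = \<alpha> and f = "\<lambda>k. e j k"])
      fix x assume "- \<gamma> - \<beta> - 1 \<le> x" "x < \<alpha>"
      then have "(j - 1, x + 1) \<in> ?T"
        using 3 by (auto simp: corner_triangle_def)
      moreover have "e j x \<otimes> e j (x + 1) = e (j - 1) (x + 1)"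
        using triangle[of j "x + 1"] e_comm[of j x j "x + 1"] by simp
      ultimately show "e j x \<otimes> e j (x + 1) \<in> lamp_group ?T"
        using e_in_lamp_group by simp
    qed (use 3 jk in \<open>auto simp: corner_triangle_def max_def split: if_splits\<close>)
    then show ?thesis using 3 by simp
  next
    case 4
    have "e j (- \<gamma> - 1 - j) \<otimes> e i' (- \<gamma> - 1 - i') \<in> lamp_group ?T"
    proof (rule telescope[where lo = "- \<gamma> - 1 - \<alpha>" and hi = \<beta> and f = "\<lambda>j. e j (- \<gamma> - 1 - j)"])
      fix x assume "- \<gamma> - 1 - \<alpha> \<le> x" "x < \<beta>"
      then have "(x + 1, - \<gamma> - 1 - x) \<in> ?T"
        using 4 by (auto simp: corner_triangle_def)
      moreover have "e x (- \<gamma> - 1 - x) = e (x + 1) (- \<gamma> - 1 - x) \<otimes> e (x + 1) (- \<gamma> - 1 - (x + 1))"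
        using triangle[of "x + 1" "- \<gamma> - 1 - x"] by (simp add: algebra_simps)
      then have "e x (- \<gamma> - 1 - x) \<otimes> e (x + 1) (- \<gamma> - 1 - (x + 1)) = e (x + 1) (- \<gamma> - 1 - x)"
        by (simp add: m_assoc)
      ultimately show "e x (- \<gamma> - 1 - x) \<otimes> e (x + 1) (- \<gamma> - 1 - (x + 1)) \<in> lamp_group ?T"
        using e_in_lamp_group by metis
    qed (use 4 jk in \<open>auto simp: corner_triangle_def max_def split: if_splits\<close>)
    moreover have "- \<gamma> - 1 - j = k" "- \<gamma> - 1 - i' = n'"
      using 4 by simp_all
    ultimately show ?thesis by simp
  qed
qed

end

section \<open>From paths to words\<close>

lemma walk:
  fixes P :: "nat \<Rightarrow> int \<Rightarrow> bool"
  assumes step: "\<And>k x x'. P k x \<Longrightarrow> \<bar>x' - x\<bar> = 1 \<Longrightarrow> P (k + c) x'" and "P k x"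
  shows "P (k + c * nat \<bar>y - x\<bar>) y"
proof -
  have "P (k + c * n) (x + sgn (y - x) * int n)" if "y \<noteq> x" for n
  proof (induction n)
    case (Suc n)
    have "\<bar>x + sgn (y - x) * int (Suc n) - (x + sgn (y - x) * int n)\<bar> = 1"
      using that by (simp add: sgn_if algebra_simps)
    from step[OF Suc this] show ?case
      by (simp add: algebra_simps)
  qed (use assms in simp)
  from this[of "nat \<bar>y - x\<bar>"] show ?thesis
    using assms(2) by (cases "y = x") (simp_all add: sgn_mult_abs)
qed

context baumslag
begin

text \<open>
  The ambiguity by a factor \<open>a\<close> on the left accounts for the lamp at the origin: the empty word cannot switch it, but
  the first letter of a nonempty word can do so at no cost.
\<close>

definition reach :: "'a set \<Rightarrow> nat \<Rightarrow> int \<Rightarrow> int \<Rightarrow> int \<Rightarrow> (int \<times> int) set \<Rightarrow> bool" where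
  "reach S k p q r V \<longleftrightarrow> (\<exists>\<alpha> \<beta> \<gamma>. insert (p, q + r) V \<subseteq> corner_triangle \<alpha> \<beta> \<gamma> \<and>
    (\<forall>m\<in>lamp_group (corner_triangle \<alpha> \<beta> \<gamma>).
      m \<otimes> z p q r \<in> ball S k \<or> a \<otimes> (m \<otimes> z p q r) \<in> ball S k))"

lemma reach_mono: "reach S k p q r V \<Longrightarrow> W \<subseteq> insert (p, q + r) V \<Longrightarrow> reach S k p q r W"
  unfolding reach_def by (meson insert_subset order_trans)

lemma reach_mono_radius: "reach S k p q r V \<Longrightarrow> k \<le> l \<Longrightarrow> reach S l p q r V"
  unfolding reach_def
  by (elim exE conjE, intro exI conjI, assumption) (use ball_mono[of k l S] in blast)

text \<open>The triangle is the origin alone, with lamp group \<open>{\<one>, a}\<close>; the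
  permitted left factor \<open>a\<close> covers both elements without a letter.\<close>

lemma reach_start: "reach S 0 0 0 0 {}"
proof -
  have gen: "x = \<one> \<or> x = a" if "x \<in> generate G {a}" for x
    using that by (induction rule: generate.induct) (auto simp: a_a)
  have "corner_triangle 0 0 0 = {(0, 0)}"
    by (auto simp: corner_triangle_def)
  then show ?thesis
    unfolding reach_def lamp_group_def
    by (intro exI[of _ 0]) (auto simp: a_a one_in_ball dest!: gen)
qed

lemma corner_triangle_mono:
  "\<alpha> \<le> \<alpha>' \<Longrightarrow> \<beta> \<le> \<beta>' \<Longrightarrow> \<gamma> \<le> \<gamma>' \<Longrightarrow> corner_triangle \<alpha> \<beta> \<gamma> \<subseteq> corner_triangle \<alpha>' \<beta>' \<gamma>'"
  by (auto simp: corner_triangle_def)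

lemma ball_mult_or:
  assumes "S \<subseteq> carrier G" "g \<in> carrier G" "x \<in> carrier G" "x \<in> insert \<one> (symm S)"
    "g \<in> ball S k \<or> a \<otimes> g \<in> ball S k"
  shows "g \<otimes> x \<in> ball S (Suc k) \<or> a \<otimes> (g \<otimes> x) \<in> ball S (Suc k)"
proof -
  have "a \<otimes> (g \<otimes> x) = a \<otimes> g \<otimes> x"
    using assms by (simp add: m_assoc)
  then show ?thesis
    using assms ball_mult by metis
qed

text \<open>Moving by \<open>x\<close> or by \<open>x \<otimes> a\<close> decides whether the lamp
  at the new position is switched. By \<open>lamp_group_step\<close> this choice and the old lamp
  group give all lamps of the enlarged triangle.\<close>

lemma reach_step:
  assumes "reach S k p q r V" and S: "S \<subseteq> carrier G" and x: "x \<in> carrier G"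
    and z': "z p' q' r' = z p q r \<otimes> x" and adj: "\<bar>p' - p\<bar> + \<bar>(q' + r') - (q + r)\<bar> \<le> 1"
    and sym: "x \<in> insert \<one> (symm S)" "x \<otimes> a \<in> insert \<one> (symm S)"
  shows "reach S (Suc k) p' q' r' (insert (p', q' + r') V)"
proof -
  obtain \<alpha> \<beta> \<gamma> where V: "insert (p, q + r) V \<subseteq> corner_triangle \<alpha> \<beta> \<gamma>"
    and ball: "\<And>m. m \<in> lamp_group (corner_triangle \<alpha> \<beta> \<gamma>) \<Longrightarrow>
      m \<otimes> z p q r \<in> ball S k \<or> a \<otimes> (m \<otimes> z p q r) \<in> ball S k"
    using assms(1) unfolding reach_def by blast
  let ?T = "corner_triangle (max \<alpha> (q' + r')) (max \<beta> p') (max \<gamma> (- (p' + (q' + r'))))"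
  have "m \<otimes> z p' q' r' \<in> ball S (Suc k) \<or> a \<otimes> (m \<otimes> z p' q' r') \<in> ball S (Suc k)"
    if m: "m \<in> lamp_group ?T" for m
  proof -
    obtain m' where m': "m' \<in> lamp_group (corner_triangle \<alpha> \<beta> \<gamma>)"
      "m = m' \<or> m = m' \<otimes> e p' (q' + r')"
      using lamp_group_step[OF _ adj m] V by blast
    have cl: "m' \<in> carrier G" using m'(1) lamp_group_closed by blast
    have "m \<otimes> z p' q' r' = m' \<otimes> z p q r \<otimes> x \<or> m \<otimes> z p' q' r' = m' \<otimes> z p q r \<otimes> (x \<otimes> a)"
      using m'(2)
    proof
      assume "m = m' \<otimes> e p' (q' + r')"
      then have "m \<otimes> z p' q' r' = m' \<otimes> (z p' q' r' \<otimes> a)"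
        using cl by (simp add: z_a m_assoc)
      then show ?thesis
        using cl x by (simp add: z' m_assoc)
    qed (use cl x in \<open>simp add: z' m_assoc\<close>)
    then show ?thesis
      using ball_mult_or[OF S _ _ _ ball[OF m'(1)], of x]
        ball_mult_or[OF S _ _ _ ball[OF m'(1)], of "x \<otimes> a"] x cl sym by auto
  qed
  moreover have "insert (p', q' + r') V \<subseteq> ?T"
  proof (intro insert_subsetI)
    show "V \<subseteq> ?T"
      by (rule subset_trans[OF _ corner_triangle_mono[of \<alpha> _ \<beta> _ \<gamma>]]) (use V in simp_all)
  qed (simp add: corner_triangle_def)
  ultimately show ?thesis
    unfolding reach_def by (metis insert_absorb2)
qed

text \<open>For two unit moves made by one letter: the four products encode the choices at the
  intermediate and the final position.\<close>

lemma reach_two_steps: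
  assumes "reach S k p q r V" and S: "S \<subseteq> carrier G" and xy: "x \<in> carrier G" "y \<in> carrier G"
    and z1: "z p1 q1 r1 = z p q r \<otimes> x" and z2: "z p2 q2 r2 = z p1 q1 r1 \<otimes> y"
    and adj: "\<bar>p1 - p\<bar> + \<bar>(q1 + r1) - (q + r)\<bar> \<le> 1" "\<bar>p2 - p1\<bar> + \<bar>(q2 + r2) - (q1 + r1)\<bar> \<le> 1"
    and sym: "{x \<otimes> y, x \<otimes> (a \<otimes> y), x \<otimes> (y \<otimes> a), x \<otimes> (a \<otimes> (y \<otimes> a))} \<subseteq> insert \<one> (symm S)"
  shows "reach S (Suc k) p2 q2 r2 (insert (p2, q2 + r2) (insert (p1, q1 + r1) V))"
proof -
  obtain \<alpha> \<beta> \<gamma> where V: "insert (p, q + r) V \<subseteq> corner_triangle \<alpha> \<beta> \<gamma>"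
    and ball: "\<And>m. m \<in> lamp_group (corner_triangle \<alpha> \<beta> \<gamma>) \<Longrightarrow>
      m \<otimes> z p q r \<in> ball S k \<or> a \<otimes> (m \<otimes> z p q r) \<in> ball S k"
    using assms(1) unfolding reach_def by blast
  define \<alpha>1 \<beta>1 \<gamma>1 where "\<alpha>1 = max \<alpha> (q1 + r1)" and "\<beta>1 = max \<beta> p1" and "\<gamma>1 = max \<gamma> (- (p1 + (q1 + r1)))"
  define \<alpha>2 \<beta>2 \<gamma>2 where "\<alpha>2 = max \<alpha>1 (q2 + r2)" and "\<beta>2 = max \<beta>1 p2" and "\<gamma>2 = max \<gamma>1 (- (p2 + (q2 + r2)))"
  note defs = \<alpha>1_def \<beta>1_def \<gamma>1_def \<alpha>2_def \<beta>2_def \<gamma>2_def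
  have V1: "(p1, q1 + r1) \<in> corner_triangle \<alpha>1 \<beta>1 \<gamma>1"
    using V by (auto simp: corner_triangle_def defs)
  have "m \<otimes> z p2 q2 r2 \<in> ball S (Suc k) \<or> a \<otimes> (m \<otimes> z p2 q2 r2) \<in> ball S (Suc k)"
    if m: "m \<in> lamp_group (corner_triangle \<alpha>2 \<beta>2 \<gamma>2)" for m
  proof -
    obtain m' where m': "m' \<in> lamp_group (corner_triangle \<alpha>1 \<beta>1 \<gamma>1)"
      "m = m' \<or> m = m' \<otimes> e p2 (q2 + r2)"
      using lamp_group_step[OF V1 adj(2) m[unfolded \<alpha>2_def \<beta>2_def \<gamma>2_def]] by blast
    obtain m0 where m0: "m0 \<in> lamp_group (corner_triangle \<alpha> \<beta> \<gamma>)"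
      "m' = m0 \<or> m' = m0 \<otimes> e p1 (q1 + r1)"
      using lamp_group_step[OF _ adj(1) m'(1)[unfolded \<alpha>1_def \<beta>1_def \<gamma>1_def]] V by blast
    have cl: "m' \<in> carrier G" "m0 \<in> carrier G" using m'(1) m0(1) lamp_group_closed by blast+
    let ?g = "m0 \<otimes> z p q r"
    have 1: "m' \<otimes> z p1 q1 r1 = ?g \<otimes> x \<or> m' \<otimes> z p1 q1 r1 = ?g \<otimes> (x \<otimes> a)"
      using m0(2)
    proof
      assume "m' = m0 \<otimes> e p1 (q1 + r1)"
      then have "m' \<otimes> z p1 q1 r1 = m0 \<otimes> (z p1 q1 r1 \<otimes> a)"
        using cl by (simp add: z_a m_assoc)
      then show ?thesis
        using cl xy by (simp add: z1 m_assoc)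
    qed (use cl xy in \<open>simp add: z1 m_assoc\<close>)
    have 2: "m \<otimes> z p2 q2 r2 = m' \<otimes> z p1 q1 r1 \<otimes> y \<or> m \<otimes> z p2 q2 r2 = m' \<otimes> z p1 q1 r1 \<otimes> (y \<otimes> a)"
      using m'(2)
    proof
      assume "m = m' \<otimes> e p2 (q2 + r2)"
      then have "m \<otimes> z p2 q2 r2 = m' \<otimes> (z p2 q2 r2 \<otimes> a)"
        using cl by (simp add: z_a m_assoc)
      then show ?thesis
        using cl xy by (simp add: z2 m_assoc)
    qed (use cl xy in \<open>simp add: z2 m_assoc\<close>)
    have "m \<otimes> z p2 q2 r2 \<in> (\<otimes>) ?g ` {x \<otimes> y, x \<otimes> (a \<otimes> y), x \<otimes> (y \<otimes> a), x \<otimes> (a \<otimes> (y \<otimes> a))}"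
      using 1 2 cl xy by (elim disjE) (simp_all add: m_assoc)
    then obtain w where "w \<in> {x \<otimes> y, x \<otimes> (a \<otimes> y), x \<otimes> (y \<otimes> a), x \<otimes> (a \<otimes> (y \<otimes> a))}"
      "m \<otimes> z p2 q2 r2 = ?g \<otimes> w"
      by blast
    moreover from this have "w \<in> carrier G"
      using xy by auto
    ultimately show ?thesis
      using ball_mult_or[OF S _ _ _ ball[OF m0(1)], of w] cl sym by auto
  qed
  moreover have "insert (p2, q2 + r2) (insert (p1, q1 + r1) V) \<subseteq> corner_triangle \<alpha>2 \<beta>2 \<gamma>2"
  proof (intro insert_subsetI)
    show "V \<subseteq> corner_triangle \<alpha>2 \<beta>2 \<gamma>2"
      by (rule subset_trans[OF _ corner_triangle_mono[of \<alpha> \<alpha>2 \<beta> \<beta>2 \<gamma> \<gamma>2]])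
        (use V in \<open>simp_all add: defs\<close>)
    show "(p1, q1 + r1) \<in> corner_triangle \<alpha>2 \<beta>2 \<gamma>2"
      by (rule subsetD[OF corner_triangle_mono V1]) (simp_all add: defs(4-6))
  qed (simp add: corner_triangle_def defs)
  ultimately show ?thesis
    unfolding reach_def by (metis insert_absorb2)
qed

text \<open>Since \<open>x\<close> bounds the height, \<open>y\<close> the column and
  \<open>w\<close> the sum, every triangle around these points contains the lamps of
  \<open>xs\<close>. The ambiguous factor \<open>a\<close> is removed by
  \<open>ball_absorb\<close>.\<close>

lemma reach_ball:
  assumes "reach S k p q r V" and S: "S \<subseteq> carrier G" "a \<in> S"
    "\<And>x. x \<in> symm S \<Longrightarrow> a \<otimes> x \<in> insert \<one> (symm S)"
    and V: "{x, y, w} \<subseteq> V" and "1 \<le> k"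
    and xs: "\<And>v. v \<in> set xs \<Longrightarrow> snd v \<le> snd x \<and> fst v \<le> fst y \<and> fst w + snd w \<le> fst v + snd v"
  shows "lamps xs \<otimes> z p q r \<in> ball S k"
proof -
  obtain \<alpha> \<beta> \<gamma> where T: "insert (p, q + r) V \<subseteq> corner_triangle \<alpha> \<beta> \<gamma>"
    and ball: "\<And>m. m \<in> lamp_group (corner_triangle \<alpha> \<beta> \<gamma>) \<Longrightarrow>
      m \<otimes> z p q r \<in> ball S k \<or> a \<otimes> (m \<otimes> z p q r) \<in> ball S k"
    using assms(1) unfolding reach_def by blast
  have "{x, y, w} \<subseteq> corner_triangle \<alpha> \<beta> \<gamma>"
    using V T by blast
  then have "set xs \<subseteq> corner_triangle \<alpha> \<beta> \<gamma>"
    using xs by (force simp: corner_triangle_def)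
  from ball[OF lamps_in_lamp_group[OF this]] show ?thesis
    using ball_absorb[OF S(1,2), of "lamps xs \<otimes> z p q r" k] S(3) \<open>1 \<le> k\<close> by auto
qed

lemma z_step:
  "z (p + 1) q r = z p q r \<otimes> s" "z (p - 1) q r = z p q r \<otimes> inv s"
  "z p (q + 1) r = z p q r \<otimes> t" "z p (q - 1) r = z p q r \<otimes> inv t"
  "z p q (r + 1) = z p q r \<otimes> u" "z p q (r - 1) = z p q r \<otimes> inv u"
  using z_add[of p q r 1 0 0] z_add[of p q r "- 1" 0 0] z_add[of p q r 0 1 0]
    z_add[of p q r 0 "- 1" 0] z_add[of p q r 0 0 1] z_add[of p q r 0 0 "- 1"]
  by (simp_all add: z_gen z_inv_gen)

lemma abs_eq_1E:
  fixes x y :: int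
  assumes "\<bar>y - x\<bar> = 1"
  obtains "y = x + 1" | "y = x - 1"
  using assms by linarith

lemma a_a_left: "x \<in> carrier G \<Longrightarrow> a \<otimes> (a \<otimes> x) = x"
  by (simp flip: m_assoc add: a_a)

lemma symm_A_absorb: "\<forall>x\<in>symm A. a \<otimes> x \<in> insert \<one> (symm A)"
  unfolding symm_A ball_simps
  by (intro conjI TrueI, simp_all only: a_a a_a_left gen_closed inv_closed m_closed,
      (rule insertI1 | rule insertI2)+)

text \<open>Diagonal moves fix the lamp position and so commute with \<open>a\<close>.\<close>

lemma diag_a: "t \<otimes> (inv u \<otimes> a) = a \<otimes> (t \<otimes> inv u)" "u \<otimes> (inv t \<otimes> a) = a \<otimes> (u \<otimes> inv t)"
proof -
  have "z 0 1 (- 1) = t \<otimes> inv u" "z 0 (- 1) 1 = u \<otimes> inv t"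
    using z_add[of 0 1 0 0 0 "- 1"] z_add[of 0 0 1 0 "- 1" 0] by (simp_all add: z_gen z_inv_gen)
  then show "t \<otimes> (inv u \<otimes> a) = a \<otimes> (t \<otimes> inv u)" "u \<otimes> (inv t \<otimes> a) = a \<otimes> (u \<otimes> inv t)"
    using z_diag_a[of "- 1"] z_diag_a[of 1] by (simp_all add: m_assoc)
qed

text \<open>The two conjugates are the lamps \<open>e 0 1\<close> and \<open>e 0 (- 1)\<close>,
  which commute with the lamp \<open>a\<close>.\<close>

lemma conj_t_a:
  "t \<otimes> (a \<otimes> (inv t \<otimes> a)) = a \<otimes> (t \<otimes> (a \<otimes> inv t))"
  "inv t \<otimes> (a \<otimes> (t \<otimes> a)) = a \<otimes> (inv t \<otimes> (a \<otimes> t))"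
proof -
  have "e 0 1 = t \<otimes> (a \<otimes> inv t)" "e 0 (- 1) = inv t \<otimes> (a \<otimes> t)"
    by (simp_all add: e_def z_gen z_inv_gen)
  then show "t \<otimes> (a \<otimes> (inv t \<otimes> a)) = a \<otimes> (t \<otimes> (a \<otimes> inv t))"
    "inv t \<otimes> (a \<otimes> (t \<otimes> a)) = a \<otimes> (inv t \<otimes> (a \<otimes> t))"
    using e_comm[of 0 1 0 0] e_comm[of 0 "- 1" 0 0] by (simp_all add: m_assoc)
qed

text \<open>Some letters have two expressions. After \<open>diag_a\<close> and
  \<open>conj_t_a\<close> have selected one of them, closure is a literal membership test.\<close>

lemma symm_B_absorb: "\<forall>x\<in>symm B. a \<otimes> x \<in> insert \<one> (symm B)"
  unfolding symm_B symm_A ball_simps ball_Un Un_insert_left Un_empty_left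
  by (intro conjI TrueI,
      simp_all only: a_a a_a_left diag_a conj_t_a gen_closed inv_closed m_closed,
      (rule insertI1 | rule insertI2)+)

section \<open>Paths spelled with the letters of \<open>A\<close>\<close>

lemma reach_A_letter:
  assumes "reach A k p q r V" "z p' q' r' = z p q r \<otimes> x" "x \<in> {s, t, u, inv s, inv t, inv u}"
    "\<bar>p' - p\<bar> + \<bar>(q' + r') - (q + r)\<bar> \<le> 1"
  shows "reach A (k + 1) p' q' r' V"
proof -
  have "x \<in> carrier G" "x \<in> symm A" "x \<otimes> a \<in> symm A"
    using assms(3) by (auto simp: symm_A)
  then have "reach A (Suc k) p' q' r' (insert (p', q' + r') V)"
    using assms by (intro reach_step[OF assms(1) A_closed]) auto
  then show ?thesis
    using reach_mono by (metis Suc_eq_plus1 insertI1 insert_absorb2 subset_insertI)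
qed

lemma reach_A_walk:
  assumes "reach A k p q r V"
  shows "reach A (k + nat \<bar>p' - p\<bar> + nat \<bar>q' - q\<bar> + nat \<bar>r' - r\<bar>) p' q' r' (insert (p', q' + r') V)"
proof -
  have p: "reach A (k + 1) p' q r V" if "reach A k p q r V" "\<bar>p' - p\<bar> = 1" for k p q r p'
    using that(2)
    by (rule abs_eq_1E) (use reach_A_letter[OF that(1) z_step(1)] reach_A_letter[OF that(1) z_step(2)] in auto)
  have q: "reach A (k + 1) p q' r V" if "reach A k p q r V" "\<bar>q' - q\<bar> = 1" for k p q r q'
    using that(2)
    by (rule abs_eq_1E) (use reach_A_letter[OF that(1) z_step(3)] reach_A_letter[OF that(1) z_step(4)] in auto)
  have r: "reach A (k + 1) p q r' V" if "reach A k p q r V" "\<bar>r' - r\<bar> = 1" for k p q r r'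
    using that(2)
    by (rule abs_eq_1E) (use reach_A_letter[OF that(1) z_step(5)] reach_A_letter[OF that(1) z_step(6)] in auto)
  have "reach A (k + 1 * nat \<bar>p' - p\<bar>) p' q r V"
    by (rule walk[where P = "\<lambda>k p. reach A k p q r V"]) (erule (1) p, rule assms)
  then have "reach A (k + 1 * nat \<bar>p' - p\<bar> + 1 * nat \<bar>q' - q\<bar>) p' q' r V"
    by (rule walk[where P = "\<lambda>k q. reach A k p' q r V", rotated]) (erule (1) q)
  then have "reach A (k + 1 * nat \<bar>p' - p\<bar> + 1 * nat \<bar>q' - q\<bar> + 1 * nat \<bar>r' - r\<bar>) p' q' r' V"
    by (rule walk[where P = "\<lambda>k r. reach A k p' q' r V", rotated]) (erule (1) r)
  then have "reach A (k + nat \<bar>p' - p\<bar> + nat \<bar>q' - q\<bar> + nat \<bar>r' - r\<bar>) p' q' r' V"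
    by simp
  then show ?thesis
    by (rule reach_mono) simp
qed

section \<open>Paths spelled with the letters of \<open>B\<close>, counted in half letters\<close>

text \<open>
  \<open>half_reach c p n d V\<close> doubles the cost: \<open>c\<close> is twice the number of letters of \<open>B\<close>, with the position
  described by \<open>n = q + r\<close> and \<open>d = q - r\<close>.  A unit change of \<open>n\<close> costs one half; for odd \<open>c\<close> the last
  such change is still waiting to be merged with another one into a single letter.
\<close>

definition half_reach :: "nat \<Rightarrow> int \<Rightarrow> int \<Rightarrow> int \<Rightarrow> (int \<times> int) set \<Rightarrow> bool" where
  "half_reach c p n d V \<longleftrightarrow> (\<exists>k q r V'. d = q - r \<and> reach B k p q r V' \<and>
    (c = 2 * k \<and> n = q + r \<and> V = V' \<or> c = 2 * k + 1 \<and> \<bar>n - (q + r)\<bar> = 1 \<and> V \<subseteq> insert (p, n) V'))"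

text \<open>Since \<open>q + r\<close> and \<open>q - r\<close> have the same parity,
  \<open>n - d\<close> is even exactly when no change of \<open>n\<close> is pending.\<close>

lemma half_reach_even:
  assumes "half_reach c p n d V" "even (n - d)"
  obtains k q r where "c = 2 * k" "n = q + r" "d = q - r" "reach B k p q r V"
  using assms(1) unfolding half_reach_def
proof (elim exE conjE disjE)
  fix q r assume "d = q - r" "\<bar>n - (q + r)\<bar> = 1"
  then have "n - d = 2 * r + 1 \<or> n - d = 2 * r - 1"
    by linarith
  then have False using assms(2) by presburger
  then show thesis ..
qed (use that in blast)

lemma half_reach_odd:
  assumes "half_reach c p n d V" "odd (n - d)"
  obtains k q r V' where "c = 2 * k + 1" "\<bar>n - (q + r)\<bar> = 1" "d = q - r" "reach B k p q r V'"
    "V \<subseteq> insert (p, n) V'"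
  using assms(1) unfolding half_reach_def
proof (elim exE conjE disjE)
  fix q r assume "d = q - r" "n = q + r"
  then have "n - d = 2 * r" by simp
  then show thesis using assms(2) by simp
qed (use that in blast)

lemma t_inv_t: "t \<otimes> (inv t \<otimes> a) = a" "inv t \<otimes> (t \<otimes> a) = a"
  by (simp_all flip: m_assoc)

lemma half_reach_n:
  assumes "half_reach c p n d V" "\<bar>n' - n\<bar> = 1"
  shows "half_reach (c + 1) p n' d (insert (p, n') V)"
proof (cases "even (n - d)")
  case True
  with assms obtain k q r where "c = 2 * k" "n = q + r" "d = q - r" "reach B k p q r V"
    by (blast elim: half_reach_even)
  then show ?thesis
    using assms(2) unfolding half_reach_def
    by (intro exI[of _ k] exI[of _ q] exI[of _ r] exI[of _ V]) auto
next
  case False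
  with assms obtain k q r V' where k: "c = 2 * k + 1" "\<bar>n - (q + r)\<bar> = 1" "d = q - r" "reach B k p q r V'"
    "V \<subseteq> insert (p, n) V'"
    by (blast elim: half_reach_odd)
  have *: "half_reach (c + 1) p n' d (insert (p, n') V)"
    if "z p q1 r1 = z p q r \<otimes> x" "z p q2 r2 = z p q1 r1 \<otimes> y" "q1 + r1 = n" "q2 + r2 = n'" "q2 - r2 = d"
      "x \<in> carrier G" "y \<in> carrier G"
      "{x \<otimes> y, x \<otimes> (a \<otimes> y), x \<otimes> (y \<otimes> a), x \<otimes> (a \<otimes> (y \<otimes> a))} \<subseteq> insert \<one> (symm B)"
    for q1 r1 q2 r2 x y
  proof -
    have "reach B (Suc k) p q2 r2 (insert (p, q2 + r2) (insert (p, q1 + r1) V'))"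
      using that k(2) assms(2) by (intro reach_two_steps[OF k(4) B_closed]) auto
    then have "reach B (Suc k) p q2 r2 (insert (p, n') V)"
      by (rule reach_mono) (use k(5) that in auto)
    then show ?thesis
      using k(1) that unfolding half_reach_def
      by (intro exI[of _ "Suc k"] exI[of _ q2] exI[of _ r2] exI[of _ "insert (p, n') V"]) auto
  qed
  \<comment> \<open>Two moves up are spelled \<open>t\<close>, \<open>u\<close>, two moves down
    \<open>inv u\<close>, \<open>inv t\<close>, and opposite moves \<open>t\<close>,
    \<open>inv t\<close> or the reverse. All keep \<open>d\<close>, and with optional factors
    \<open>a\<close> they form letters of \<open>B\<close> or cancel.\<close>
  consider "n = q + r + 1" "n' = n + 1" | "n = q + r + 1" "n' = n - 1"
    | "n = q + r - 1" "n' = n + 1" | "n = q + r - 1" "n' = n - 1"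
    using k(2) assms(2) by linarith
  then show ?thesis
  proof cases
    case 1
    show ?thesis
      by (rule *[OF z_step(3) z_step(5)]) (use 1 k in \<open>auto simp: symm_B\<close>)
  next
    case 2
    show ?thesis
      by (rule *[OF z_step(3) z_step(4)]) (use 2 k in \<open>auto simp: t_inv_t symm_B symm_A\<close>)
  next
    case 3
    show ?thesis
      by (rule *[OF z_step(4) z_step(3)]) (use 3 k in \<open>auto simp: t_inv_t symm_B symm_A\<close>)
  next
    case 4
    show ?thesis
      by (rule *[OF z_step(6) z_step(4)]) (use 4 k in \<open>auto simp: symm_B\<close>)
  qed
qed

text \<open>A pending change without a partner is executed alone. This shifts \<open>d\<close> by 1
  in a direction of choice: \<open>t\<close> and \<open>u\<close> both raise \<open>n\<close> but
  move \<open>d\<close> oppositely.\<close>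

lemma half_reach_commit:
  assumes "half_reach c p n d V" "odd (n - d)" "\<bar>d' - d\<bar> = 1"
  shows "half_reach (c + 1) p n d' V"
proof -
  obtain k q r V' where k: "c = 2 * k + 1" "\<bar>n - (q + r)\<bar> = 1" "d = q - r" "reach B k p q r V'"
    "V \<subseteq> insert (p, n) V'"
    using assms by (blast elim: half_reach_odd)
  have *: "half_reach (c + 1) p n d' V"
    if "z p q1 r1 = z p q r \<otimes> x" "q1 + r1 = n" "q1 - r1 = d'" "x \<in> carrier G" "x \<in> insert \<one> (symm B)"
      "x \<otimes> a \<in> insert \<one> (symm B)" for q1 r1 x
  proof -
    have "reach B (Suc k) p q1 r1 (insert (p, q1 + r1) V')"
      using that k(2) by (intro reach_step[OF k(4) B_closed]) auto
    then have "reach B (Suc k) p q1 r1 V"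
      by (rule reach_mono) (use k(5) that in auto)
    then show ?thesis
      using k(1) that unfolding half_reach_def
      by (intro exI[of _ "Suc k"] exI[of _ q1] exI[of _ r1] exI[of _ V]) auto
  qed
  consider "n = q + r + 1" "d' = d + 1" | "n = q + r + 1" "d' = d - 1"
    | "n = q + r - 1" "d' = d + 1" | "n = q + r - 1" "d' = d - 1"
    using k(2) assms(3) by linarith
  then show ?thesis
  proof cases
    case 1 show ?thesis
      by (rule *[OF z_step(3)]) (use 1 k in \<open>auto simp: symm_B symm_A\<close>)
  next
    case 2 show ?thesis
      by (rule *[OF z_step(5)]) (use 2 k in \<open>auto simp: symm_B symm_A\<close>)
  next
    case 3 show ?thesis
      by (rule *[OF z_step(6)]) (use 3 k in \<open>auto simp: symm_B symm_A\<close>)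
  next
    case 4 show ?thesis
      by (rule *[OF z_step(4)]) (use 4 k in \<open>auto simp: symm_B symm_A\<close>)
  qed
qed

lemma half_reach_p:
  assumes "half_reach c p n d V" "even (n - d)" "\<bar>p' - p\<bar> = 1"
  shows "half_reach (c + 2) p' n d V"
proof -
  obtain k q r where k: "c = 2 * k" "n = q + r" "d = q - r" "reach B k p q r V"
    using assms by (blast elim: half_reach_even)
  have "reach B (Suc k) p' q r (insert (p', q + r) V)"
    using assms(3)
  proof (rule abs_eq_1E)
    assume "p' = p + 1"
    then show ?thesis
      using reach_step[OF k(4) B_closed _ z_step(1)] by (auto simp: symm_B symm_A)
  next
    assume "p' = p - 1"
    then show ?thesis
      using reach_step[OF k(4) B_closed _ z_step(2)] by (auto simp: symm_B symm_A)
  qed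
  then have "reach B (Suc k) p' q r V"
    by (rule reach_mono) auto
  with k show ?thesis
    unfolding half_reach_def by (intro exI[of _ "Suc k"] exI[of _ q] exI[of _ r] exI[of _ V]) auto
qed

lemma half_reach_d:
  assumes "half_reach c p n d V" "even (n - d)" "\<bar>d' - d\<bar> = 2"
  shows "half_reach (c + 2) p n d' V"
proof -
  obtain k q r where k: "c = 2 * k" "n = q + r" "d = q - r" "reach B k p q r V"
    using assms by (blast elim: half_reach_even)
  have *: "half_reach (c + 2) p n d' V"
    if "z p q1 r1 = z p q r \<otimes> x" "q1 + r1 = n" "q1 - r1 = d'" "x \<in> carrier G" "x \<in> insert \<one> (symm B)"
      "x \<otimes> a \<in> insert \<one> (symm B)" for q1 r1 x
  proof -
    have "reach B (Suc k) p q1 r1 (insert (p, q1 + r1) V)"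
      using that k(2) by (intro reach_step[OF k(4) B_closed]) auto
    then have "reach B (Suc k) p q1 r1 V"
      by (rule reach_mono) auto
    then show ?thesis
      using k(1) that unfolding half_reach_def
      by (intro exI[of _ "Suc k"] exI[of _ q1] exI[of _ r1] exI[of _ V]) auto
  qed
  consider "d' = d + 2" | "d' = d - 2"
    using assms(3) by linarith
  then show ?thesis
  proof cases
    case 1
    have "z p (q + 1) (r - 1) = z p q r \<otimes> (t \<otimes> inv u)"
      using z_step(3)[of p q r] z_step(6)[of p "q + 1" r] by (simp add: m_assoc)
    then show ?thesis
      by (rule *) (use 1 k in \<open>auto simp: symm_B m_assoc\<close>)
  next
    case 2
    have "z p (q - 1) (r + 1) = z p q r \<otimes> (u \<otimes> inv t)"
      using z_step(5)[of p q r] z_step(4)[of p q "r + 1"] by (simp add: m_assoc)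
    then show ?thesis
      by (rule *) (use 2 k in \<open>auto simp: symm_B m_assoc diag_a\<close>)
  qed
qed

lemma half_reach_mono:
  "half_reach c p n d V \<Longrightarrow> W \<subseteq> insert (p, n) V \<Longrightarrow> half_reach c p n d W"
  unfolding half_reach_def by (elim exE conjE disjE) (metis reach_mono, blast)

lemma half_reach_walk_n:
  assumes "half_reach c p n d V"
  shows "half_reach (c + nat \<bar>n' - n\<bar>) p n' d (insert (p, n') V)"
proof -
  have "half_reach (c + 1 * nat \<bar>n' - n\<bar>) p n' d V"
  proof (rule walk[where P = "\<lambda>c n. half_reach c p n d V"])
    fix k x x' assume "half_reach k p x d V" "\<bar>x' - x\<bar> = 1"
    then show "half_reach (k + 1) p x' d V"
      by (intro half_reach_mono[OF half_reach_n]) auto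
  qed fact
  then have "half_reach (c + nat \<bar>n' - n\<bar>) p n' d V"
    by simp
  then show ?thesis
    by (rule half_reach_mono) simp
qed

lemma half_reach_walk_p:
  assumes "half_reach c p n d V" "even (n - d)"
  shows "half_reach (c + 2 * nat \<bar>p' - p\<bar>) p' n d V"
  by (rule walk[where P = "\<lambda>c p. half_reach c p n d V"])
    (erule half_reach_p, rule assms, assumption, rule assms)

lemma half_reach_walk_d:
  assumes "half_reach c p n d V" "even (n - d)" "even (d' - d)"
  shows "half_reach (c + nat \<bar>d' - d\<bar>) p n d' V"
proof -
  obtain k where k: "d' = d + 2 * k"
    using assms(3) by (metis add.commute diff_add_cancel dvd_def)
  have "half_reach (c + 2 * nat \<bar>k - 0\<bar>) p n (d + 2 * k) V"
  proof (rule walk[where P = "\<lambda>c k. half_reach c p n (d + 2 * k) V"])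
    fix l x x' assume *: "half_reach l p n (d + 2 * x) V" "\<bar>x' - x\<bar> = 1"
    have "even (n - (d + 2 * x))"
      using assms(2) by presburger
    then show "half_reach (l + 2) p n (d + 2 * x') V"
      by (rule half_reach_d[OF *(1)]) (use *(2) in linarith)
  qed (use assms in simp)
  then show ?thesis
    by (simp add: k abs_mult nat_mult_distrib)
qed

end

lemma finite_maximum:
  fixes f :: "'b \<Rightarrow> int"
  assumes "finite S" "S \<noteq> {}"
  obtains x where "x \<in> S" "\<And>y. y \<in> S \<Longrightarrow> f y \<le> f x"
proof -
  have "Max (f ` S) \<in> f ` S"
    using assms by simp
  then obtain x where "x \<in> S" "f x = Max (f ` S)"
    by auto
  then show thesis
    using that assms by (metis Max_ge finite_imageI imageI)
qed

context baumslag
begin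

text \<open>A pending change is committed towards the target \<open>D\<close>, so its effect on
  \<open>d\<close> is progress unless \<open>d = D\<close>.\<close>

lemma half_reach_settle:
  assumes "half_reach c p n d V"
  obtains d' where "even (n - d')" "\<bar>d' - d\<bar> \<le> 1" "d \<noteq> D \<Longrightarrow> \<bar>d' - d\<bar> + \<bar>D - d'\<bar> = \<bar>D - d\<bar>"
    "half_reach (c + nat \<bar>d' - d\<bar>) p n d' V"
proof (cases "even (n - d)")
  case True
  then show thesis using that[of d] assms by simp
next
  case False
  define d' where "d' = (if D < d then d - 1 else d + 1)"
  have d': "\<bar>d' - d\<bar> = 1" "d \<noteq> D \<Longrightarrow> \<bar>d' - d\<bar> + \<bar>D - d'\<bar> = \<bar>D - d\<bar>" "even (n - d')"
    using False by (auto simp: d'_def)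
  then show thesis
    using that[of d'] half_reach_commit[OF assms False d'(1)] by simp
qed

text \<open>
  A path visiting three given points can be rearranged to have only two maximal stretches in
  the \<open>n\<close>-direction, so at most two changes of \<open>n\<close> remain unpaired.
\<close>

lemma half_reach_three_points:
  assumes "even (n - D)"
  shows "\<exists>c. half_reach c p n D {(i1, n1), (i2, n2), (i3, n3)} \<and>
    int c \<le> step_cost 2 (0, 0) (i1, n1) + step_cost 2 (i1, n1) (i2, n2) + step_cost 2 (i2, n2) (i3, n3)
      + step_cost 2 (i3, n3) (p, n) + \<bar>D\<bar> + 2"
proof -
  have "half_reach 0 0 0 0 {}"
    unfolding half_reach_def using reach_start by (intro exI[of _ 0] exI[of _ "{}"]) simp
  \<comment> \<open>The route turns at (i1, 0), (i1, n1), (i1, n2), (i2, n2), (i3, n2), (i3, n3),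
    (i3, n) and ends at (p, n). It costs as much as the direct path through the three
    points.\<close>
  from half_reach_walk_n[OF half_reach_walk_n[OF half_reach_walk_p[OF this, of i1], of n1], of n2]
  have "half_reach (2 * nat \<bar>i1\<bar> + nat \<bar>n1\<bar> + nat \<bar>n2 - n1\<bar>) i1 n2 0 {(i1, n1)}"
    by (auto intro: half_reach_mono)
  then obtain d1 where d1: "even (n2 - d1)" "\<bar>d1\<bar> \<le> 1" "D \<noteq> 0 \<Longrightarrow> \<bar>d1\<bar> + \<bar>D - d1\<bar> = \<bar>D\<bar>"
    and r: "half_reach (2 * nat \<bar>i1\<bar> + nat \<bar>n1\<bar> + nat \<bar>n2 - n1\<bar> + nat \<bar>d1\<bar>) i1 n2 d1 {(i1, n1)}"
    by (rule half_reach_settle[where D = D]) (use that in auto)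
  define c1 where "c1 = 2 * nat \<bar>i1\<bar> + nat \<bar>n1\<bar> + nat \<bar>n2 - n1\<bar> + nat \<bar>d1\<bar> + 2 * nat \<bar>i2 - i1\<bar>"
  have r2: "half_reach c1 i2 n2 d1 {(i1, n1), (i2, n2)}"
    using half_reach_walk_p[OF r d1(1), of i2] unfolding c1_def by (rule half_reach_mono) auto
  from half_reach_walk_n[OF half_reach_walk_n[OF half_reach_walk_p[OF r2 d1(1), of i3], of n3], of n]
  have "half_reach (c1 + 2 * nat \<bar>i3 - i2\<bar> + nat \<bar>n3 - n2\<bar> + nat \<bar>n - n3\<bar>) i3 n d1
      {(i1, n1), (i2, n2), (i3, n3)}"
    by (rule half_reach_mono) auto
  then obtain d2 where d2: "even (n - d2)" "\<bar>d2 - d1\<bar> \<le> 1" "D \<noteq> d1 \<Longrightarrow> \<bar>d2 - d1\<bar> + \<bar>D - d2\<bar> = \<bar>D - d1\<bar>"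
    and r3: "half_reach (c1 + 2 * nat \<bar>i3 - i2\<bar> + nat \<bar>n3 - n2\<bar> + nat \<bar>n - n3\<bar> + nat \<bar>d2 - d1\<bar>)
      i3 n d2 {(i1, n1), (i2, n2), (i3, n3)}"
    by (rule half_reach_settle[where D = D]) (use that in auto)
  define c2 where "c2 = c1 + 2 * nat \<bar>i3 - i2\<bar> + nat \<bar>n3 - n2\<bar> + nat \<bar>n - n3\<bar> + nat \<bar>d2 - d1\<bar>
    + 2 * nat \<bar>p - i3\<bar> + nat \<bar>D - d2\<bar>"
  have "even (D - d2)"
    using assms d2(1) by presburger
  then have "half_reach c2 p n D {(i1, n1), (i2, n2), (i3, n3)}"
    unfolding c2_def by (intro half_reach_walk_d half_reach_walk_p r3 d2(1))
  \<comment> \<open>Settling leads away from \<open>D\<close> only if \<open>d\<close> is already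
    \<open>D\<close>. This happens at most once, by 1, and the way back costs another 1.\<close>
  moreover have "\<bar>d1\<bar> + \<bar>d2 - d1\<bar> + \<bar>D - d2\<bar> \<le> \<bar>D\<bar> + 2"
    using d1(2,3) d2(2,3) by linarith
  then have "int c2 \<le> step_cost 2 (0, 0) (i1, n1) + step_cost 2 (i1, n1) (i2, n2)
      + step_cost 2 (i2, n2) (i3, n3) + step_cost 2 (i3, n3) (p, n) + \<bar>D\<bar> + 2"
    by (simp add: c2_def c1_def step_cost_def abs_minus_commute)
  ultimately show ?thesis by blast
qed

text \<open>Of the slack 4, one half pays for the unpaired changes of \<open>n\<close> and the other
  for the letter saved.\<close>

lemma ball_B_of_tour:
  assumes cost: "path_cost 2 ((0, 0) # xs @ [(p, q + r)]) \<le> c" and l: "c + \<bar>q - r\<bar> + 4 \<le> 2 * int l"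
  shows "lamps xs \<otimes> z p q r \<in> ball B (l - 1)"
proof -
  let ?xs = "(0, 0) # xs @ [(p, q + r)]"
  \<comment> \<open>Three extreme points determine the smallest triangle around the path, so a
    cheaper path need only visit these.\<close>
  obtain x where x: "x \<in> set ?xs" "\<And>v. v \<in> set ?xs \<Longrightarrow> snd v \<le> snd x"
    using finite_maximum[of "set ?xs" snd] by (metis finite_set list.distinct(1) set_empty)
  obtain y where y: "y \<in> set ?xs" "\<And>v. v \<in> set ?xs \<Longrightarrow> fst v \<le> fst y"
    using finite_maximum[of "set ?xs" fst] by (metis finite_set list.distinct(1) set_empty)
  obtain w where w: "w \<in> set ?xs" "\<And>v. v \<in> set ?xs \<Longrightarrow> - (fst v + snd v) \<le> - (fst w + snd w)"
    using finite_maximum[of "set ?xs" "\<lambda>v. - (fst v + snd v)"]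
    by (metis finite_set list.distinct(1) set_empty)
  obtain p1 p2 p3 where P: "{p1, p2, p3} = {x, y, w}"
    "step_cost 2 (hd ?xs) p1 + step_cost 2 p1 p2 + step_cost 2 p2 p3 + step_cost 2 p3 (last ?xs)
      \<le> path_cost 2 ?xs"
    using ordered_waypoints[OF zero_le_numeral x(1) y(1) w(1)] by blast
  have nonneg: "0 \<le> c"
    using P(2) cost step_cost_nonneg[of 2] by (smt (verit))
  obtain k where k: "half_reach k p (q + r) (q - r) {p1, p2, p3}"
    "int k \<le> path_cost 2 ?xs + \<bar>q - r\<bar> + 2"
    using half_reach_three_points[of "q + r" "q - r" p "fst p1" "snd p1" "fst p2" "snd p2" "fst p3" "snd p3"] P(2)
    by auto
  obtain k' q' r' where k': "k = 2 * k'" "q + r = q' + r'" "q - r = q' - r'" "reach B k' p q' r' {p1, p2, p3}"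
    by (rule half_reach_even[OF k(1)]) auto
  moreover from this have "q' = q" "r' = r"
    by linarith+
  ultimately have k': "k = 2 * k'" "reach B k' p q r {p1, p2, p3}"
    by simp_all
  have r: "reach B (l - 1) p q r {p1, p2, p3}"
    by (rule reach_mono_radius[OF k'(2)]) (use k(2) k'(1) cost l in linarith)
  have l1: "1 \<le> l - 1"
    using l nonneg by linarith
  have aB: "a \<in> B"
    by (simp add: B_def A_def)
  show ?thesis
  proof (rule reach_ball[OF r B_closed aB, where x = x and y = y and w = w])
    show "snd v \<le> snd x \<and> fst v \<le> fst y \<and> fst w + snd w \<le> fst v + snd v" if "v \<in> set xs" for v
      using x(2)[of v] y(2)[of v] w(2)[of v] that by simp
  qed (use symm_B_absorb P(1) l1 in auto)
qed

section \<open>Invariants of lamp configurations from an action\<close>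

text \<open>
  If \<open>W\<close> satisfies the triangle relation modulo 2, it extends to a linear functional on lamp configurations; the last
  component of the state records its value.  The action is a right action.
\<close>

definition lamp_action ::
    "(int \<Rightarrow> int \<Rightarrow> bool) \<Rightarrow> ('a \<Rightarrow> int \<times> int \<times> int \<times> bool \<Rightarrow> int \<times> int \<times> int \<times> bool) \<Rightarrow> bool" where
  "lamp_action W act \<longleftrightarrow>
    (\<forall>x\<in>carrier G. \<forall>y\<in>carrier G. \<forall>S. act (x \<otimes> y) S = act y (act x S)) \<and> (\<forall>S. act \<one> S = S) \<and>
    (\<forall>p q r b. act a (p, q, r, b) = (p, q, r, b \<noteq> W p (q + r)) \<and> act s (p, q, r, b) = (p + 1, q, r, b) \<and>
      act t (p, q, r, b) = (p, q + 1, r, b) \<and> act u (p, q, r, b) = (p, q, r + 1, b))"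

lemma lamp_action_inv_gen:
  assumes "lamp_action W act"
  shows "act (inv s) (p, q, r, b) = (p - 1, q, r, b)" "act (inv t) (p, q, r, b) = (p, q - 1, r, b)"
    "act (inv u) (p, q, r, b) = (p, q, r - 1, b)"
proof -
  have *: "act (inv x) (act x S) = S" if "x \<in> carrier G" for x S
    using assms that unfolding lamp_action_def by (metis inv_closed r_inv)
  show "act (inv s) (p, q, r, b) = (p - 1, q, r, b)" "act (inv t) (p, q, r, b) = (p, q - 1, r, b)"
    "act (inv u) (p, q, r, b) = (p, q, r - 1, b)"
    using assms *[of s "(p - 1, q, r, b)"] *[of t "(p, q - 1, r, b)"] *[of u "(p, q, r - 1, b)"]
    by (simp_all add: lamp_action_def)
qed

lemma lamp_action_z:
  assumes "lamp_action W act"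
  shows "act (z p q r) (p0, q0, r0, b) = (p0 + p, q0 + q, r0 + r, b)"
proof -
  note act = assms[unfolded lamp_action_def] lamp_action_inv_gen[OF assms]
  have "act (z p 0 0) (p0, q0, r0, b) = (p0 + p, q0, r0, b)"
    by (induction p rule: int_induct[where k = 0]) (simp_all only: z_step, simp_all add: act)
  moreover have "act (z p q 0) (p0, q0, r0, b) = (p0 + p, q0 + q, r0, b)"
    by (induction q rule: int_induct[where k = 0]) (simp_all only: z_step, simp_all add: act calculation)
  moreover have "act (z p q r) (p0, q0, r0, b) = (p0 + p, q0 + q, r0 + r, b)"
    by (induction r rule: int_induct[where k = 0]) (simp_all only: z_step, simp_all add: act calculation)
  ultimately show ?thesis by simp
qed

lemma lamp_action_lamps:
  assumes "lamp_action W act"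
  shows "act (lamps xs \<otimes> z p q r) (0, 0, 0, b) =
    (p, q, r, b \<noteq> odd (length (filter (\<lambda>(i, n). W i n) xs)))"
proof -
  note act = assms[unfolded lamp_action_def] lamp_action_z[OF assms]
  have e: "act (e i n) (0, 0, 0, b) = (0, 0, 0, b \<noteq> W i n)" for i n b
    by (simp add: e_def act)
  have "act (lamps xs) (0, 0, 0, b) = (0, 0, 0, b \<noteq> odd (length (filter (\<lambda>(i, n). W i n) xs)))" for b
  proof (induction xs arbitrary: b)
    case (Cons v xs)
    obtain i n where v: "v = (i, n)" by force
    have "act (lamps (v # xs)) (0, 0, 0, b) = act (lamps xs) (0, 0, 0, b \<noteq> W i n)"
      using act(1) by (simp add: v e)
    then show ?case
      using Cons by (auto simp: v)
  qed (simp add: act)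
  then show ?thesis
    by (simp add: act)
qed

end

section \<open>The two generating sets\<close>

text \<open>\<open>pascal_bit i n\<close> is the coefficient of \<open>x\<^sup>n\<close> in \<open>(1 + x)\<^sup>-\<^sup>i\<close> modulo 2.\<close>

definition pascal_bit :: "int \<Rightarrow> int \<Rightarrow> bool" where
  "pascal_bit i n \<longleftrightarrow> 0 \<le> n \<and> odd ((if i \<le> 0 then nat (- i) else nat i + nat n - 1) choose nat n)"

text \<open>Lowering \<open>i\<close> by one multiplies the series by 1 + x; this compares the
  coefficients modulo 2.\<close>

lemma pascal_bit_rec: "pascal_bit (i - 1) n \<longleftrightarrow> pascal_bit i n \<noteq> pascal_bit i (n - 1)"
proof -
  consider "n < 0" | "n = 0" | k where "n = int (Suc k)"
  proof -
    have "n < 0 \<or> n = 0 \<or> n = int (Suc (nat (n - 1)))" by linarith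
    then show thesis using that by blast
  qed
  then show ?thesis
  proof cases
    case 3
    \<comment> \<open>The case \<open>i = 1\<close> is separate because there \<open>i - 1\<close>
      and \<open>i\<close> fall under different branches of the definition.\<close>
    consider x where "i = - int x" | "i = 1" | y where "i = int y + 2"
    proof -
      have "i \<le> 0 \<or> i = 1 \<or> 2 \<le> i" by linarith
      then show thesis
        using that(1)[of "nat (- i)"] that(2) that(3)[of "nat (i - 2)"] by fastforce
    qed
    then show ?thesis
    proof cases
      case (1 x)
      have "nat (- (i - 1)) = Suc x" "nat n = Suc k" "nat (n - 1) = k"
        using 1 3 by simp_all
      then show ?thesis
        using 1 3 by (auto simp: pascal_bit_def)
    next
      case 2
      have "nat n = Suc k" "nat (n - 1) = k"
        using 3 by simp_all
      then show ?thesis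
        using 2 3 by (simp add: pascal_bit_def)
    next
      case (3 y)
      have "nat n = Suc k" "nat (n - 1) = k" "nat (i - 1) = Suc y" "nat i = Suc (Suc y)"
        using 3 \<open>n = int (Suc k)\<close> by simp_all
      then show ?thesis
        using 3 \<open>n = int (Suc k)\<close> by (auto simp: pascal_bit_def)
    qed
  qed (simp_all add: pascal_bit_def)
qed

text \<open>The relations yield words, hence upper bounds on lengths; lower bounds come from the
  action, which separates lamp configurations.\<close>

locale baumslag_lamp = baumslag +
  assumes lamp_action_exists:
      "(\<forall>i n. W (i - 1) n \<longleftrightarrow> W i n \<noteq> W i (n - 1)) \<Longrightarrow> \<exists>act. lamp_action W act"
    and generate_A: "generate G A = carrier G"
begin

text \<open>With \<open>W\<close> constantly false the action records just the three
  exponents.\<close>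

lemma normal_form_unique:
  assumes eq: "lamps xs \<otimes> z p q r = lamps ys \<otimes> z p' q' r'"
  shows "p = p' \<and> q = q' \<and> r = r'"
proof -
  obtain act where "lamp_action (\<lambda>_ _. False) act"
    using lamp_action_exists[of "\<lambda>_ _. False"] by auto
  then show ?thesis
    using eq lamp_action_lamps[of _ act xs p q r False] lamp_action_lamps[of _ act ys p' q' r' False]
    by auto
qed

lemma normal_form_parity:
  assumes W: "\<And>i n. W (i - 1) n \<longleftrightarrow> W i n \<noteq> W i (n - 1)"
    and eq: "lamps xs \<otimes> z p q r = lamps ys \<otimes> z p' q' r'"
    and odd: "odd (length (filter (\<lambda>(i, n). W i n) ys))"
  shows "\<exists>(i, n)\<in>set xs. W i n"
proof -
  obtain act where "lamp_action W act"
    using lamp_action_exists[of W] W by auto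
  then have "odd (length (filter (\<lambda>(i, n). W i n) xs))"
    using eq odd lamp_action_lamps[of W act xs p q r False] lamp_action_lamps[of W act ys p' q' r' False]
    by auto
  then have "filter (\<lambda>(i, n). W i n) xs \<noteq> []"
    by auto
  then show ?thesis
    by (fastforce simp: filter_empty_conv)
qed

section \<open>Dead ends for \<open>A\<close>\<close>

definition peak :: "int \<Rightarrow> (int \<times> int) list" where
  "peak N = [(0, N), (N, 0), (0, - N)]"

text \<open>For each side of the triangle a translated, possibly reflected \<open>pascal_bit\<close>
  gives a functional supported on or beyond that side. It is 1 on exactly one of the three lamps of
  the peak, so every expression for the peak has a lamp in the support.\<close>

lemma peak_extent:
  assumes eq: "lamps xs \<otimes> z p q r = lamps (peak N)" and N: "1 \<le> N"
  shows "\<exists>v\<in>set xs. N \<le> snd v" "\<exists>v\<in>set xs. N \<le> fst v" "\<exists>v\<in>set xs. fst v + snd v \<le> - N"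
proof -
  have eq': "lamps xs \<otimes> z p q r = lamps (peak N) \<otimes> z 0 0 0"
    using eq by simp
  have "\<exists>(i, n)\<in>set xs. pascal_bit i (n - N)"
  proof (rule normal_form_parity[OF _ eq'], goal_cases)
    case (1 i n)
    show ?case
      using pascal_bit_rec[of i "n - N"] by (auto simp: algebra_simps)
  qed (use N in \<open>simp add: peak_def pascal_bit_def\<close>)
  then obtain i n where "(i, n) \<in> set xs" "pascal_bit i (n - N)"
    by auto
  then show "\<exists>v\<in>set xs. N \<le> snd v"
    by (intro bexI[of _ "(i, n)"]) (auto simp: pascal_bit_def)
  have "\<exists>(i, n)\<in>set xs. pascal_bit n (i - N)"
  proof (rule normal_form_parity[OF _ eq'], goal_cases)
    case (1 i n)
    show ?case
      using pascal_bit_rec[of n "i - N"] by (auto simp: algebra_simps)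
  qed (use N in \<open>simp add: peak_def pascal_bit_def\<close>)
  then obtain i n where "(i, n) \<in> set xs" "pascal_bit n (i - N)"
    by auto
  then show "\<exists>v\<in>set xs. N \<le> fst v"
    by (intro bexI[of _ "(i, n)"]) (auto simp: pascal_bit_def)
  have "\<exists>(i, n)\<in>set xs. pascal_bit i (- (i + n) - N)"
  proof (rule normal_form_parity[OF _ eq'], goal_cases)
    case (1 i n)
    have "- (i - 1 + n) - N = - (i + n) - N + 1" "- (i + (n - 1)) - N = - (i + n) - N + 1"
      by simp_all
    then show ?case
      using pascal_bit_rec[of i "- (i + n) - N + 1"] by (simp only: add_diff_cancel_right') blast
  qed (use N in \<open>simp add: peak_def pascal_bit_def\<close>)
  then obtain i n where "(i, n) \<in> set xs" "pascal_bit i (- (i + n) - N)"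
    by auto
  then show "\<exists>v\<in>set xs. fst v + snd v \<le> - N"
    by (intro bexI[of _ "(i, n)"]) (auto simp: pascal_bit_def)
qed

text \<open>A closed path costs at least twice its extent in each coordinate. It goes
  \<open>N\<close> to the right, \<open>N\<close> up, and in total at least \<open>N\<close> to the
  left and down, because \<open>i + n\<close> reaches \<open>- N\<close>.\<close>

lemma peak_length:
  assumes "lamps (peak N) \<in> ball A k" "1 \<le> N"
  shows "6 * N \<le> int k"
proof -
  obtain c d where "bounded_tour 1 (lamps (peak N)) c d" "c \<le> int k"
    using ball_A_tour[OF assms(1)] by blast
  then obtain xs p q r where xs: "lamps (peak N) = lamps xs \<otimes> z p q r"
    and cost: "path_cost 1 ((0, 0) # xs @ [(p, q + r)]) \<le> int k"
    unfolding bounded_tour_def tour_def by fastforce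
  have pos: "p = 0" "q + r = 0"
    using normal_form_unique[of xs p q r "peak N" 0 0 0] xs by auto
  let ?xs = "(0, 0) # xs @ [(p, q + r)]"
  obtain x y w where x: "x \<in> set ?xs" "N \<le> snd x" and y: "y \<in> set ?xs" "N \<le> fst y"
    and w: "w \<in> set ?xs" "fst w + snd w \<le> - N"
    using peak_extent[OF xs[symmetric] assms(2)] by fastforce
  obtain p1 p2 p3 where P: "{p1, p2, p3} = {x, y, w}"
    "step_cost 1 (hd ?xs) p1 + step_cost 1 p1 p2 + step_cost 1 p2 p3 + step_cost 1 p3 (last ?xs)
      \<le> path_cost 1 ?xs"
    using ordered_waypoints[OF zero_le_one x(1) y(1) w(1)] by blast
  have loop: "2 * (j - min 0 k) \<le> \<bar>i1\<bar> + \<bar>i1 - i2\<bar> + \<bar>i2 - i3\<bar> + \<bar>i3\<bar>"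
    if "j \<in> {i1, i2, i3}" "k \<in> {i1, i2, i3}" for i1 i2 i3 j k :: int
    using that by auto
  have "x \<in> {p1, p2, p3}" "y \<in> {p1, p2, p3}" "w \<in> {p1, p2, p3}"
    using P(1) by blast+
  then have "2 * (fst y - min 0 (fst w)) \<le> \<bar>fst p1\<bar> + \<bar>fst p1 - fst p2\<bar> + \<bar>fst p2 - fst p3\<bar> + \<bar>fst p3\<bar>"
    "2 * (snd x - min 0 (snd w)) \<le> \<bar>snd p1\<bar> + \<bar>snd p1 - snd p2\<bar> + \<bar>snd p2 - snd p3\<bar> + \<bar>snd p3\<bar>"
    using loop[of "fst y" "fst p1" "fst p2" "fst p3" "fst w"] loop[of "snd x" "snd p1" "snd p2" "snd p3" "snd w"]
    by blast+
  moreover have "N \<le> - min 0 (fst w) - min 0 (snd w)"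
    using w(2) by linarith
  ultimately show ?thesis
    using x(2) y(2) P(2) cost by (simp add: step_cost_def pos)
qed

text \<open>The lamps differing from the peak lie within distance \<open>k\<close> of the origin,
  hence inside its triangle. It remains to find a route of length at most \<open>6 * N\<close>
  touching all three sides and ending at the new position.\<close>

lemma near_peak:
  assumes "inv (lamps (peak N)) \<otimes> h \<in> ball A k" and h: "h \<in> carrier G" and N: "3 * int k + 1 \<le> N"
  shows "h \<in> ball A (nat (6 * N))"
proof -
  obtain c d where "bounded_tour 1 (inv (lamps (peak N)) \<otimes> h) c d" "c \<le> int k" "\<bar>d\<bar> \<le> int k"
    using ball_A_tour[OF assms(1)] by blast
  then obtain xs p q r where xs: "inv (lamps (peak N)) \<otimes> h = lamps xs \<otimes> z p q r"
    and cost: "path_cost 1 ((0, 0) # xs @ [(p, q + r)]) \<le> int k" and qr: "\<bar>q - r\<bar> \<le> int k"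
    unfolding bounded_tour_def tour_def by fastforce
  have "h = lamps (peak N) \<otimes> (inv (lamps (peak N)) \<otimes> h)"
    using h by (simp flip: m_assoc)
  then have h': "h = lamps (peak N @ xs) \<otimes> z p q r"
    by (simp add: xs lamps_append m_assoc)
  have near: "\<bar>fst v\<bar> + \<bar>snd v\<bar> \<le> int k" if "v \<in> set (xs @ [(p, q + r)])" for v
  proof -
    let ?xs = "(0, 0) # xs @ [(p, q + r)]"
    have v: "v \<in> set ?xs"
      using that by simp
    obtain p1 p2 p3 where "{p1, p2, p3} = {v, v, v}"
      "step_cost 1 (hd ?xs) p1 + step_cost 1 p1 p2 + step_cost 1 p2 p3 + step_cost 1 p3 (last ?xs)
        \<le> path_cost 1 ?xs"
      using ordered_waypoints[OF zero_le_one v v v] by blast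
    moreover from this(1) have "p1 = v" "p2 = v" "p3 = v"
      by auto
    ultimately have "step_cost 1 (0, 0) v + step_cost 1 v (p, q + r) \<le> int k"
      using cost by (simp add: step_cost_def)
    then show ?thesis
      by (simp add: step_cost_def)
  qed
  have pos: "\<bar>p\<bar> + \<bar>q\<bar> + \<bar>r\<bar> \<le> N"
    using near[of "(p, q + r)"] qr N by auto
  define R where "R c p q r V \<longleftrightarrow> (\<exists>l. reach A l p q r V \<and> int l \<le> c)" for c p q r V
  have start: "R 0 0 0 0 {}"
    unfolding R_def using reach_start[of A] by (intro exI[of _ 0]) simp
  have R_walk: "R c' p' q' r' V'"
    if "R c p q r V" "c + \<bar>p' - p\<bar> + \<bar>q' - q\<bar> + \<bar>r' - r\<bar> \<le> c'" "V' \<subseteq> insert (p', q' + r') V"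
    for c p q r V c' p' q' r' V'
  proof -
    obtain l where l: "reach A l p q r V" "int l \<le> c"
      using \<open>R c p q r V\<close> by (auto simp: R_def)
    have "reach A (l + nat \<bar>p' - p\<bar> + nat \<bar>q' - q\<bar> + nat \<bar>r' - r\<bar>) p' q' r' V'"
      by (rule reach_mono[OF reach_A_walk[OF l(1)]]) (use that(3) in auto)
    moreover have "int (l + nat \<bar>p' - p\<bar> + nat \<bar>q' - q\<bar> + nat \<bar>r' - r\<bar>) \<le> c'"
      using l(2) that(2) by simp
    ultimately show ?thesis
      unfolding R_def by blast
  qed
  \<comment> \<open>Within column \<open>i\<close> the path visits heights \<open>N\<close> and
    \<open>- m\<close>. Ending on the side of the height visited last saves the distance of the end
    from the origin.\<close>
  have excursion: "\<exists>V. R (c + 2 * N + 2 * m - \<bar>q + r\<bar>) i q r V \<and> {(i, N), (i, - m), v} \<subseteq> V"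
    if start: "R c i 0 0 {v}" and m: "\<bar>q\<bar> + \<bar>r\<bar> \<le> m" "m \<le> N" for c i v m
  proof (cases "q + r \<le> 0")
    case True
    \<comment> \<open>The height \<open>- m\<close> is shared between \<open>q\<close> and
      \<open>r\<close> so that neither exponent backtracks within a leg. The other case shares
      \<open>N\<close> in the same way.\<close>
    define r' where "r' = min r 0"
    have r': "- m \<le> r'" "r' \<le> 0" "r' \<le> r" "- m - r' \<le> q"
      using m by (auto simp: r'_def)
    have "R (c + N) i N 0 {(i, N), v}"
      by (rule R_walk[OF start]) (use m in auto)
    then have "R (c + N + (N + m)) i (- m - r') r' {(i, - m), (i, N), v}"
      by (rule R_walk) (use r' m in auto)
    then have "R (c + 2 * N + 2 * m - \<bar>q + r\<bar>) i q r {(i, - m), (i, N), v}"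
      by (rule R_walk) (use r' True in auto)
    then show ?thesis by blast
  next
    case False
    define r' where "r' = max r 0"
    have r': "r' \<le> N" "0 \<le> r'" "r \<le> r'" "q \<le> N - r'"
      using m by (auto simp: r'_def)
    have "R (c + m) i (- m) 0 {(i, - m), v}"
      by (rule R_walk[OF start]) (use m in auto)
    then have "R (c + m + (N + m)) i (N - r') r' {(i, N), (i, - m), v}"
      by (rule R_walk) (use r' m in auto)
    then have "R (c + 2 * N + 2 * m - \<bar>q + r\<bar>) i q r {(i, N), (i, - m), v}"
      by (rule R_walk) (use r' False in auto)
    then show ?thesis by blast
  qed
  have "\<exists>V x y w. R (6 * N) p q r V \<and> {x, y, w} \<subseteq> V \<and>
      N \<le> snd x \<and> N \<le> fst y \<and> fst w + snd w \<le> - N"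
  \<comment> \<open>For \<open>p\<close> nonnegative, the excursion in column 0 comes first and
    column \<open>N\<close> is visited on the way to \<open>p\<close>. For \<open>p\<close>
    negative, (N, 0) comes first; in column \<open>p\<close> depth \<open>N + p\<close> suffices,
    since there the sum is already \<open>- N\<close>.\<close>
  proof (cases "0 \<le> p")
    case True
    have "R 0 0 0 0 {(0, 0)}"
      by (rule R_walk[OF start]) auto
    moreover have "\<bar>q\<bar> + \<bar>r\<bar> \<le> N"
      using pos by linarith
    ultimately obtain V where V: "R (4 * N - \<bar>q + r\<bar>) 0 q r V" "{(0, N), (0, - N)} \<subseteq> V"
      using excursion[of 0 0 "(0, 0)" N] by auto
    have "R (5 * N - \<bar>q + r\<bar>) N q r (insert (N, q + r) V)"
      by (rule R_walk[OF V(1)]) (use pos in auto)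
    then have "R (6 * N) p q r (insert (N, q + r) V)"
      by (rule R_walk) (use pos True in auto)
    then show ?thesis
      using V(2)
      by (intro exI[of _ "insert (N, q + r) V"] exI[of _ "(0, N)"] exI[of _ "(N, q + r)"]
          exI[of _ "(0, - N)"]) auto
  next
    case False
    have "R N N 0 0 {(N, 0)}"
      by (rule R_walk[OF start]) (use pos in auto)
    then have "R (2 * N - p) p 0 0 {(N, 0)}"
      by (rule R_walk) (use pos False in auto)
    then obtain V where V: "R (2 * N - p + 2 * N + 2 * (N + p) - \<bar>q + r\<bar>) p q r V"
      "{(p, N), (p, - (N + p)), (N, 0)} \<subseteq> V"
      using excursion[of "2 * N - p" p "(N, 0)" "N + p"] pos False by auto
    have "R (6 * N) p q r V"
      by (rule R_walk[OF V(1)]) (use False in auto)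
    then show ?thesis
      using V(2)
      by (intro exI[of _ V] exI[of _ "(p, N)"] exI[of _ "(N, 0)"] exI[of _ "(p, - (N + p))"]) auto
  qed
  then obtain l V x y w where l: "reach A l p q r V" "int l \<le> 6 * N" "{x, y, w} \<subseteq> V"
      and ext: "N \<le> snd x" "N \<le> fst y" "fst w + snd w \<le> - N"
    unfolding R_def by blast
  have "reach A (nat (6 * N)) p q r V"
    by (rule reach_mono_radius[OF l(1)]) (use l(2) in linarith)
  then show ?thesis
    unfolding h'
  proof (rule reach_ball[OF _ A_closed, where x = x and y = y and w = w])
    show "snd v \<le> snd x \<and> fst v \<le> fst y \<and> fst w + snd w \<le> fst v + snd v" if "v \<in> set (peak N @ xs)" for v
    proof -
      have "v \<in> set (peak N) \<or> \<bar>fst v\<bar> + \<bar>snd v\<bar> \<le> int k"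
        using that near[of v] by auto
      then show ?thesis
        using ext N by (auto simp: peak_def)
    qed
  qed (use l(3) N symm_A_absorb in \<open>auto simp: A_def\<close>)
qed

lemma unbounded_depth_A: "unbounded_dead_end_depth G A"
  unfolding unbounded_dead_end_depth_def
proof
  fix k :: nat
  define N where "N = 3 * int k + 1"
  let ?g = "lamps (peak N)"
  have N: "1 \<le> N" by (simp add: N_def)
  have len: "enat (nat (6 * N)) \<le> word_dist G A \<one> ?g"
  proof (cases "word_dist G A \<one> ?g")
    case (enat l)
    then have "?g \<in> ball A l"
      using word_dist_le_iff[of A \<one> ?g l] by simp
    from peak_length[OF this N] show ?thesis
      using enat by (simp add: nat_le_iff)
  qed simp
  have "enat (Suc k) \<le> word_dist G A ?g h"
    if h: "h \<in> carrier G" "word_dist G A \<one> h > word_dist G A \<one> ?g" for h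
  proof (rule ccontr)
    assume "\<not> enat (Suc k) \<le> word_dist G A ?g h"
    then have "word_dist G A ?g h \<le> enat k"
      by (cases "word_dist G A ?g h") auto
    then have "h \<in> ball A (nat (6 * N))"
      using near_peak[of N h k] h by (simp add: word_dist_le_iff N_def)
    then have "word_dist G A \<one> h \<le> enat (nat (6 * N))"
      using h by (simp add: word_dist_le_iff)
    with len h show False by auto
  qed
  then have "enat (Suc k) \<le> dead_end_depth G A ?g"
    unfolding dead_end_depth_def by (intro Inf_greatest) auto
  then have "enat k < dead_end_depth G A ?g"
    by (rule less_le_trans[rotated]) simp
  then show "\<exists>g\<in>carrier G. dead_end_depth G A g > enat k"
    by (intro bexI[of _ ?g]) auto
qed

section \<open>Bounded depth for \<open>B\<close>\<close>

lemma generate_B: "generate G B = carrier G"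
  using generate_A mono_generate[of A B] generate_incl[OF B_closed] by (auto simp: B_def)

lemma depth_B_le_2:
  assumes g: "g \<in> carrier G"
  shows "dead_end_depth G B g \<le> 2"
proof -
  obtain k where k: "g \<in> ball B k"
    using generate_ball[OF B_closed] generate_B g by auto
  then obtain xs0 p0 q0 r0 where g0: "g = lamps xs0 \<otimes> z p0 q0 r0"
    using ball_B_tour[OF k] by (auto simp: bounded_tour_def tour_def)
  \<comment> \<open>The sign makes the absolute value of \<open>q0 - r0\<close> grow by 4 when
    passing to \<open>h\<close>.\<close>
  define \<sigma> :: int where "\<sigma> = (if q0 \<ge> r0 then 1 else - 1)"
  define h where "h = g \<otimes> z 0 (2 * \<sigma>) (- 2 * \<sigma>)"
  have h: "h \<in> carrier G" by (simp add: h_def g)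
  have h0: "h = lamps xs0 \<otimes> z p0 (q0 + 2 * \<sigma>) (r0 - 2 * \<sigma>)"
    by (simp add: h_def g0 m_assoc z_add)
  have zz: "z 0 1 (- 1) \<in> symm B" "z 0 (- 1) 1 \<in> symm B"
    using z_add[of 0 1 0 0 0 "- 1"] z_add[of 0 0 1 0 "- 1" 0]
    by (simp_all add: z_gen z_inv_gen symm_B)
  have "z 0 \<sigma> (- \<sigma>) \<in> symm B"
    using zz by (simp add: \<sigma>_def)
  then have "\<one> \<otimes> z 0 \<sigma> (- \<sigma>) \<otimes> z 0 \<sigma> (- \<sigma>) \<in> ball B (Suc (Suc 0))"
    by (intro ball_mult B_closed one_in_ball) auto
  then have "inv g \<otimes> h \<in> ball B 2"
    using g by (simp add: h_def z_add numeral_2_eq_2 flip: m_assoc)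
  then have dist: "word_dist G B g h \<le> 2"
    using word_dist_le_iff[of B g h 2] by (simp add: numeral_eq_enat)
  have "word_dist G B \<one> h > word_dist G B \<one> g"
  proof (rule ccontr)
    assume "\<not> word_dist G B \<one> h > word_dist G B \<one> g"
    then have le: "word_dist G B \<one> h \<le> word_dist G B \<one> g" by simp
    also have "\<dots> \<le> enat k"
      using k g by (simp add: word_dist_le_iff)
    finally obtain l where l: "word_dist G B \<one> h = enat l"
      by (cases "word_dist G B \<one> h") auto
    then have "h \<in> ball B l"
      using word_dist_le_iff[of B \<one> h l] h by simp
    then obtain c d where "bounded_tour 2 h c d" "c + \<bar>d\<bar> \<le> 2 * int l"
      using ball_B_tour by blast
    then obtain xs p q r where xs: "h = lamps xs \<otimes> z p q r"
      and cost: "path_cost 2 ((0, 0) # xs @ [(p, q + r)]) \<le> c" "c + \<bar>q - r\<bar> \<le> 2 * int l"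
      by (auto simp: bounded_tour_def tour_def)
    have pos: "p = p0" "q = q0 + 2 * \<sigma>" "r = r0 - 2 * \<sigma>"
      using normal_form_unique xs h0 by metis+
    have "g = h \<otimes> z 0 (- 2 * \<sigma>) (2 * \<sigma>)"
      using g by (simp add: h_def m_assoc z_add)
    \<comment> \<open>The tour of \<open>h\<close> also serves \<open>g\<close>, since
      \<open>q + r = q0 + r0\<close>.\<close>
    then have g': "g = lamps xs \<otimes> z p q0 r0"
      by (simp add: xs m_assoc z_add pos)
    have "g \<in> ball B (l - 1)"
      unfolding g' by (rule ball_B_of_tour[of _ _ _ _ c]) (use cost pos in \<open>auto simp: \<sigma>_def split: if_splits\<close>)
    then have "word_dist G B \<one> g \<le> enat (l - 1)"
      using g by (simp add: word_dist_le_iff)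
    then have "l \<le> l - 1"
      using le l by (metis enat_ord_simps(1) order_trans)
    \<comment> \<open>With truncated subtraction \<open>l = 0\<close> survives; it is excluded
      because a trivial \<open>h\<close> has no room for a nonzero \<open>q - r\<close>.\<close>
    then have "l = 0" by simp
    then have "c + \<bar>q - r\<bar> \<le> 0" "2 \<le> \<bar>q - r\<bar>"
      using cost(2) pos by (auto simp: \<sigma>_def split: if_splits)
    moreover have "0 \<le> c"
      using cost(1) path_cost_nonneg[of 2 "(0, 0) # xs @ [(p, q + r)]"] by simp
    ultimately show False by simp
  qed
  then show ?thesis
    unfolding dead_end_depth_def using dist h by (intro Inf_lower2[OF _ dist]) auto
qed

end

section \<open>The presented group\<close>

fun lamp_step :: "(int \<Rightarrow> int \<Rightarrow> bool) \<Rightarrow> K_gen \<times> bool \<Rightarrow>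
    int \<times> int \<times> int \<times> bool \<Rightarrow> int \<times> int \<times> int \<times> bool" where
  "lamp_step W (Gen_a, c) (p, q, r, b) = (p, q, r, b \<noteq> W p (q + r))"
| "lamp_step W (Gen_s, c) (p, q, r, b) = (if c then p + 1 else p - 1, q, r, b)"
| "lamp_step W (Gen_t, c) (p, q, r, b) = (p, if c then q + 1 else q - 1, r, b)"
| "lamp_step W (Gen_u, c) (p, q, r, b) = (p, q, if c then r + 1 else r - 1, b)"

lemma lamp_step_inv_letter: "lamp_step W (inv_letter l) (lamp_step W l S) = S"
proof -
  obtain x c p q r b where "l = (x, c)" "S = (p, q, r, b)"
    by (metis prod_cases4 surj_pair)
  then show ?thesis
    by (cases x) auto
qed

text \<open>The relator from \<open>a_s\<close> switches the three lamps of a triangle, where the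
  condition on \<open>W\<close> applies; the one from \<open>a_u\<close> switches the same lamp
  twice, since \<open>W\<close> is read at \<open>q + r\<close>.\<close>

lemma lamp_step_relator:
  assumes W: "\<forall>i n. W (i - 1) n \<longleftrightarrow> W i n \<noteq> W i (n - 1)" and "x \<in> K_relators"
  shows "fold (lamp_step W) x S = S"
proof -
  obtain p q r b where S: "S = (p, q, r, b)"
    by (metis prod_cases4)
  have "W (p - 1) (q + r) \<longleftrightarrow> W p (q + r) \<noteq> W p (q + r - 1)" "W p (q - 1 + r) = W p (q + r - 1)"
    "W p (q + (r - 1)) = W p (q + r - 1)"
    using W by (simp_all add: algebra_simps)
  with assms(2) show ?thesis
    by (auto simp: K_relators_def comm_word_def conj_word_def inv_word_def S)
qed

lemma fold_lamp_step_pres_eq: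
  assumes W: "\<forall>i n. W (i - 1) n \<longleftrightarrow> W i n \<noteq> W i (n - 1)" and "pres_eq K_relators v w"
  shows "fold (lamp_step W) v = fold (lamp_step W) w"
  using assms(2)
proof induction
  case (cancel u l v)
  show ?case
    by (simp add: fun_eq_iff lamp_step_inv_letter)
next
  case (relator x u v)
  then show ?case
    by (simp add: fun_eq_iff lamp_step_relator[OF W])
qed simp_all

lemma (in group) commute_of_commutator:
  assumes "x \<in> carrier G" "y \<in> carrier G" "inv x \<otimes> (inv y \<otimes> (x \<otimes> y)) = \<one>"
  shows "x \<otimes> y = y \<otimes> x"
proof -
  have "x \<otimes> y = y \<otimes> (x \<otimes> (inv x \<otimes> (inv y \<otimes> (x \<otimes> y))))"
    using assms(1,2) by (simp flip: m_assoc)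
  also have "\<dots> = y \<otimes> x"
    using assms by (simp add: assms(3))
  finally show ?thesis .
qed

abbreviation "cls \<equiv> word_class K_relators"

lemma group_K: "group K"
  by (simp add: K_def group_presented_group)

lemma cls_closed [simp]: "cls w \<in> carrier K"
  by (simp add: K_def carrier_presented_group)

lemma cls_append: "cls (v @ w) = cls v \<otimes>\<^bsub>K\<^esub> cls w"
  by (simp add: K_def mult_word_class)

lemma cls_Nil: "cls [] = \<one>\<^bsub>K\<^esub>"
  by (simp add: K_def one_presented_group)

lemma cls_inv_word: "cls (inv_word w) = inv\<^bsub>K\<^esub> cls w"
  by (rule group.inv_equality[OF group_K, symmetric])
    (simp_all flip: cls_append cls_Nil add: word_class_eq_iff pres_eq_inv_word_left)

lemma cls_relator: "x \<in> K_relators \<Longrightarrow> cls x = \<one>\<^bsub>K\<^esub>"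
  using pres_eq.relator[of x K_relators "[]" "[]"] by (simp flip: cls_Nil add: word_class_eq_iff)

interpretation K: group K
  by (rule group_K)

interpretation K: baumslag K "cls w_a" "cls w_s" "cls w_t" "cls w_u"
proof
  let ?a = "cls w_a" and ?s = "cls w_s" and ?t = "cls w_t" and ?u = "cls w_u"
  show aa: "?a \<otimes>\<^bsub>K\<^esub> ?a = \<one>\<^bsub>K\<^esub>"
    unfolding cls_append[symmetric] by (rule cls_relator) (simp add: K_relators_def)
  have inva: "inv\<^bsub>K\<^esub> ?a = ?a"
    by (rule K.inv_equality) (simp_all add: aa)
  have comm: "cls v \<otimes>\<^bsub>K\<^esub> cls w = cls w \<otimes>\<^bsub>K\<^esub> cls v" if "comm_word v w \<in> K_relators" for v w
    using K.commute_of_commutator[of "cls v" "cls w"] cls_relator[OF that]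
    by (simp add: comm_word_def cls_append cls_inv_word K.m_assoc)
  show "?s \<otimes>\<^bsub>K\<^esub> ?t = ?t \<otimes>\<^bsub>K\<^esub> ?s" "?s \<otimes>\<^bsub>K\<^esub> ?u = ?u \<otimes>\<^bsub>K\<^esub> ?s"
    "?t \<otimes>\<^bsub>K\<^esub> ?u = ?u \<otimes>\<^bsub>K\<^esub> ?t"
    by (rule comm, simp add: K_relators_def)+
  let ?c = "inv\<^bsub>K\<^esub> ?t \<otimes>\<^bsub>K\<^esub> ?a \<otimes>\<^bsub>K\<^esub> ?t"
  have conj: "cls (conj_word v w) = inv\<^bsub>K\<^esub> cls w \<otimes>\<^bsub>K\<^esub> cls v \<otimes>\<^bsub>K\<^esub> cls w" for v w
    by (simp add: conj_word_def cls_append cls_inv_word K.m_assoc)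
  have ac: "?a \<otimes>\<^bsub>K\<^esub> cls (conj_word w_a w_t) = cls (conj_word w_a w_t) \<otimes>\<^bsub>K\<^esub> ?a"
    by (rule comm) (simp add: K_relators_def)
  then show "?a \<otimes>\<^bsub>K\<^esub> ?c = ?c \<otimes>\<^bsub>K\<^esub> ?a"
    by (simp only: conj)
  have cc: "inv\<^bsub>K\<^esub> ?c = ?c"
    by (simp add: K.inv_mult_group inva K.m_assoc)
  \<comment> \<open>The relator inverts a conjugate of \<open>a\<close>. The inverses disappear
    because \<open>?a\<close> and \<open>?c\<close> are commuting involutions.\<close>
  have "cls (conj_word (inv_word w_a) w_s) \<otimes>\<^bsub>K\<^esub> (?a \<otimes>\<^bsub>K\<^esub> ?c) = \<one>\<^bsub>K\<^esub>"
    unfolding conj[of w_a w_t, symmetric] cls_append[symmetric]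
    by (rule cls_relator) (simp add: K_relators_def)
  then have "inv\<^bsub>K\<^esub> (?a \<otimes>\<^bsub>K\<^esub> ?c) = inv\<^bsub>K\<^esub> ?s \<otimes>\<^bsub>K\<^esub> ?a \<otimes>\<^bsub>K\<^esub> ?s"
    by (intro K.inv_equality) (simp_all add: conj cls_inv_word inva)
  then show "inv\<^bsub>K\<^esub> ?s \<otimes>\<^bsub>K\<^esub> ?a \<otimes>\<^bsub>K\<^esub> ?s = ?a \<otimes>\<^bsub>K\<^esub> ?c"
    using ac by (simp add: K.inv_mult_group[of ?a ?c] cc inva conj)
  have "cls (conj_word (inv_word w_a) w_u) \<otimes>\<^bsub>K\<^esub> ?c = \<one>\<^bsub>K\<^esub>"
    unfolding conj[of w_a w_t, symmetric] cls_append[symmetric]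
    by (rule cls_relator) (simp add: K_relators_def)
  then have "inv\<^bsub>K\<^esub> ?c = inv\<^bsub>K\<^esub> ?u \<otimes>\<^bsub>K\<^esub> ?a \<otimes>\<^bsub>K\<^esub> ?u"
    by (intro K.inv_equality) (simp_all add: conj cls_inv_word inva)
  then show "inv\<^bsub>K\<^esub> ?u \<otimes>\<^bsub>K\<^esub> ?a \<otimes>\<^bsub>K\<^esub> ?u = ?c"
    by (simp add: cc)
qed simp_all

lemma gens_A_eq: "gens_A = K.A"
  unfolding gens_A_def K.A_def Let_def image_insert image_empty cls_append ..

lemma gens_B_eq: "gens_B = K.B"
  unfolding gens_B_def K.B_def Let_def image_insert image_empty cls_append cls_inv_word gens_A_eq ..

interpretation K: baumslag_lamp K "cls w_a" "cls w_s" "cls w_t" "cls w_u"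
proof
  show "\<exists>act. K.lamp_action W act" if W: "\<forall>i n. W (i - 1) n \<longleftrightarrow> W i n \<noteq> W i (n - 1)" for W
  proof -
    \<comment> \<open>Any representative may be chosen: equal classes give equal maps by
      \<open>fold_lamp_step_pres_eq\<close>.\<close>
    define act where "act X = fold (lamp_step W) (SOME w. X = cls w)" for X
    have act: "act (cls w) = fold (lamp_step W) w" for w
    proof -
      have "cls w = cls (SOME v. cls w = cls v)"
        by (rule someI[of "\<lambda>v. cls w = cls v" w]) (rule HOL.refl)
      then show ?thesis
        unfolding act_def using fold_lamp_step_pres_eq[OF W] by (metis word_class_eq_iff)
    qed
    have "act (X \<otimes>\<^bsub>K\<^esub> Y) S = act Y (act X S)" if "X \<in> carrier K" "Y \<in> carrier K" for X Y S
      using that by (auto simp: K_def carrier_presented_group mult_word_class act)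
    moreover have "act \<one>\<^bsub>K\<^esub> S = S" for S
      using act[of "[]"] by (simp add: cls_Nil)
    ultimately have "K.lamp_action W act"
      by (simp add: K.lamp_action_def act)
    then show ?thesis
      by (rule exI[of _ act])
  qed
  have letter: "cls [l] \<in> generate K K.A" for l
  proof -
    obtain x c where l: "l = (x, c)" by force
    have x: "cls [(x, True)] \<in> K.A"
      by (cases x) (simp_all add: K.A_def)
    show ?thesis
    proof (cases c)
      case True
      then show ?thesis using generate.incl[OF x] l by simp
    next
      case False
      then show ?thesis
        using generate.inv[OF x, of K] cls_inv_word[of "[(x, True)]"] l by (simp add: inv_word_def)
    qed
  qed
  have "cls w \<in> generate K K.A" for w
  proof (induction w)
    case Nil
    then show ?case by (simp add: cls_Nil generate.one)
  next
    case (Cons l w)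
    then show ?case
      using generate.eng[OF letter[of l] Cons] cls_append[of "[l]" w] by simp
  qed
  then show "generate K K.A = carrier K"
    using K.generate_incl[OF K.A_closed] by (auto simp: K_def carrier_presented_group)
qed

theorem theorem1:
  shows "finite_generating_set K gens_A \<and> unbounded_dead_end_depth K gens_A \<and>
    finite_generating_set K gens_B \<and> (\<forall>g\<in>carrier K. dead_end_depth K gens_B g \<le> 2)"
  unfolding gens_A_eq gens_B_eq finite_generating_set_def
  using K.A_closed K.B_closed K.generate_A K.generate_B K.unbounded_depth_A K.depth_B_le_2
  by (simp add: K.A_def K.B_def)

end
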